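(* Let $(X,T)$ be a topological dynamical system satisfying the specification property, let $\mathcal{F}=\{f_n\}_{n\ge1}$ and $\Phi=\{\varphi_n\}_{n\ge1}$ be asymptotically additive potentials on $X$, and let $\mathcal{G}=\{g_n\}_{n\ge1}$ and $\Psi=\{\psi_n\}_{n\ge1}$ be asymptotically additive potentials on $X$ for which there is a constant $\sigma>0$ with $\frac1n g_n(x)\ge\sigma$ and $\frac1n\psi_n(x)\ge\sigma$ for all $n\in\mathbb{N}$ and $x\in X$. Then for any $\alpha\in\mathbb{R}$ with $E_{\Phi,\Psi}(\alpha)\ne\emptyset$, $$\sup_{x\in E_{\Phi,\Psi}(\alpha)}\limsup_{n\to\infty}\frac{f_n(x)}{g_n(x)}=\sup\Big\{\frac{\mathcal{F}_*(\mu)}{\mathcal{G}_*(\mu)}:\mu\in\mathcal{M}_T,\ \frac{\Phi_*(\mu)}{\Psi_*(\mu)}=\alpha\Big\}=\sup\Big\{\frac{\mathcal{F}_*(\mu)}{\mathcal{G}_*(\mu)}:\mu\in\bigcup_{x\in E_{\Phi,\Psi}(\alpha)}\mathcal{V}(x)\Big\}.$$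
   Context: $X$ is a compact metric space with metric $d$ and $T:X\to X$ is continuous. $\mathcal{M}_T$ denotes the set of $T$-invariant Borel probability measures on $X$. For $f\in C(X)$, $S_nf=\sum_{i=0}^{n-1}f\circ T^i$. A sequence $\mathcal{F}=\{f_n\}_{n\ge1}\subset C(X)$ is an asymptotically additive potential (AAP) if for every $\xi>0$ there is $f_\xi\in C(X)$ with $\limsup_{n\to\infty}\frac1n\|f_n-S_nf_\xi\|_\infty<\xi$; for $\mu\in\mathcal{M}_T$, $\mathcal{F}_*(\mu)=\lim_{n\to\infty}\frac1n\int f_n\,d\mu$ (this limit exists). $E_{\Phi,\Psi}(\alpha)=\{x\in X:\lim_{n\to\infty}\varphi_n(x)/\psi_n(x)=\alpha\}$. For $x\in X$, $\mathcal{V}(x)$ is the set of weak$^*$ limit points of $\delta_{x,n}=\frac1n\sum_{i=0}^{n-1}\delta_{T^ix}$. $(X,T)$ has the specification property if for every $\epsilon>0$ there is an integer $m(\epsilon)$ such that for any finite collection of intervals $[a_j,b_j]\subset\mathbb{N}$, $j=1,\dots,k$, with $a_{j+1}-b_j\ge m(\epsilon)$ for $j=1,\dots,k-1$, and any $x_1,\dots,x_k\in X$, there is $x\in X$ with $d(T^{p+a_j}x,T^px_j)<\epsilon$ for all $p=0,1,\dots,b_j-a_j$ and all $j$. *)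

theory Defs
  imports "HOL-Analysis.Analysis" "HOL-Probability.Probability"
begin

definition birk :: "('a \<Rightarrow> 'a) \<Rightarrow> ('a \<Rightarrow> real) \<Rightarrow> nat \<Rightarrow> 'a \<Rightarrow> real" where
  "birk T h n x = (\<Sum>i<n. h ((T ^^ i) x))"

definition invariant_measures :: "('a::topological_space \<Rightarrow> 'a) \<Rightarrow> 'a measure set" where
  "invariant_measures T = {\<mu>. prob_space \<mu> \<and> sets \<mu> = sets borel \<and>
      (\<forall>A\<in>sets borel. emeasure \<mu> (T -` A) = emeasure \<mu> A)}"

text \<open>Asymptotically additive potential (indices n \<ge> 1; the value at n = 0 is irrelevant).\<close>
definition AAP :: "('a::topological_space \<Rightarrow> 'a) \<Rightarrow> (nat \<Rightarrow> 'a \<Rightarrow> real) \<Rightarrow> bool" where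
  "AAP T f \<longleftrightarrow> (\<forall>n\<ge>1. continuous_on UNIV (f n)) \<and>
     (\<forall>\<xi>>0. \<exists>h. continuous_on UNIV h \<and>
        limsup (\<lambda>n. ereal ((SUP x. \<bar>f n x - birk T h n x\<bar>) / real n)) < ereal \<xi>)"

definition pot_star :: "(nat \<Rightarrow> 'a \<Rightarrow> real) \<Rightarrow> 'a measure \<Rightarrow> real" where
  "pot_star f \<mu> = lim (\<lambda>n. (\<integral>x. f n x \<partial>\<mu>) / real n)"

definition level_set :: "(nat \<Rightarrow> 'a \<Rightarrow> real) \<Rightarrow> (nat \<Rightarrow> 'a \<Rightarrow> real) \<Rightarrow> real \<Rightarrow> 'a set" where
  "level_set \<phi> \<psi> \<alpha> = {x. (\<lambda>n. \<phi> n x / \<psi> n x) \<longlonglongrightarrow> \<alpha>}"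

text \<open>Weak* limit points of the empirical measures delta_{x,n}: Borel probability measures
  mu such that along some subsequence n_k, (1/n_k) sum_{i<n_k} h(T^i x) \<rightarrow> int h dmu for all h in C(X).\<close>
definition empirical_limits :: "('a::topological_space \<Rightarrow> 'a) \<Rightarrow> 'a \<Rightarrow> 'a measure set" where
  "empirical_limits T x = {\<mu>. prob_space \<mu> \<and> sets \<mu> = sets borel \<and>
     (\<exists>r. strict_mono r \<and> (\<forall>h. continuous_on UNIV h \<longrightarrow>
        (\<lambda>k. birk T h (r k) x / real (r k)) \<longlonglongrightarrow> (\<integral>y. h y \<partial>\<mu>)))}"

definition has_specification :: "('a::metric_space \<Rightarrow> 'a) \<Rightarrow> bool" where
  "has_specification T \<longleftrightarrow> (\<forall>\<epsilon>>0. \<exists>m::nat. \<forall>(k::nat) (a::nat \<Rightarrow> nat) (b::nat \<Rightarrow> nat) (xs::nat \<Rightarrow> 'a).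
     (\<forall>j<k. a j \<le> b j) \<and> (\<forall>j. Suc j < k \<longrightarrow> b j + m \<le> a (Suc j)) \<longrightarrow>
     (\<exists>x. \<forall>j<k. \<forall>p\<le>b j - a j. dist ((T ^^ (p + a j)) x) ((T ^^ p) (xs j)) < \<epsilon>))"

end

theory Submission
  imports Defs
begin

text \<open>
  Every \<^term>\<open>\<mu> \<in> empirical_limits T x\<close> is invariant, and along the corresponding subsequence
  f_n(x)/n tends to \<^term>\<open>pot_star f \<mu>\<close>. So a subsequence realising the limsup of f_n(x)/g_n(x), refined
  by weak* compactness, shows that the first supremum is at most the third, and
  every limit measure of a point of the level set satisfies the constraint of the second supremum.
  Weak* compactness is transported from the real line: a compact metric space is a continuous image
  of a compact set of reals, where Helly's selection theorem and Tietze's extension theorem apply.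

  For the remaining inequality it suffices to find, for each invariant \<^term>\<open>\<mu>\<close>, a point whose Birkhoff
  averages converge to the \<^term>\<open>\<mu>\<close>-integrals for countably many continuous functions, namely those
  approximating the four potentials. Neither ergodic decomposition nor the ergodic theorem is needed:
  by invariance the integral of h is the integral of its n-th Birkhoff average, hence nearly an
  arithmetic mean of finitely many such averages, and specification glues the
  corresponding orbit segments periodically. Doing this with finer and finer precision over
  rapidly growing time windows gives orbits that converge to the required point.
\<close>

section \<open>Weak* compactness\<close>

lemma separating_sequence:
  assumes "compact (UNIV :: 'a::metric_space set)"
  obtains U :: "nat \<Rightarrow> 'a::metric_space set"
  where "\<And>\<epsilon>::real. \<epsilon> > 0 \<Longrightarrow> \<exists>M. \<forall>x y. (\<forall>j<M. x \<in> U j \<longleftrightarrow> y \<in> U j) \<longrightarrow> dist x y < \<epsilon>"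
proof -
  have "\<exists>k::'a set. finite k \<and> UNIV \<subseteq> (\<Union>x\<in>k. ball x (1 / Suc n))" for n
    using compact_eq_totally_bounded[of "UNIV :: 'a set"] assms by (meson of_nat_0_less_iff zero_less_Suc zero_less_divide_1_iff)
  then obtain k :: "nat \<Rightarrow> 'a set"
    where k: "\<And>n. finite (k n)" "\<And>n. UNIV \<subseteq> (\<Union>x\<in>k n. ball x (1 / Suc n))" by metis
  \<comment> \<open>The balls of all levels form one countable family. Points that agree on the
    balls of level \<open>n\<close> lie in a common one, so their distance is below 2/(n+1). Level
    \<open>n\<close> uses finitely many indices, and their maximum yields the required
    \<open>M\<close>.\<close>
  define C where "C = (\<Union>n. (\<lambda>c. ball c (1 / Suc n)) ` k n)"
  have count: "countable C" unfolding C_def using k(1) by (auto intro: countable_finite)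
  have "k 0 \<noteq> {}" using k(2)[of 0] by force
  then have ne: "C \<noteq> {}" unfolding C_def by auto
  have "\<exists>M. \<forall>x y. (\<forall>j<M. x \<in> from_nat_into C j \<longleftrightarrow> y \<in> from_nat_into C j) \<longrightarrow> dist x y < \<epsilon>"
    if pos: "\<epsilon> > 0" for \<epsilon> :: real
  proof -
    obtain n where n: "1 / real (Suc n) < \<epsilon> / 2"
      using pos nat_approx_posE[of "\<epsilon>/2"] by (metis half_gt_zero)
    define I where "I = to_nat_on C ` (\<lambda>c. ball c (1 / Suc n)) ` k n"
    have fin: "finite I" unfolding I_def using k(1) by auto
    have "dist x y < \<epsilon>" if *: "\<forall>j<Suc (Max I). x \<in> from_nat_into C j \<longleftrightarrow> y \<in> from_nat_into C j" for x y
    proof -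
      obtain c where c: "c \<in> k n" "x \<in> ball c (1 / Suc n)" using k(2)[of n] by (auto simp: subset_iff)
      define j where "j = to_nat_on C (ball c (1 / Suc n))"
      have j: "from_nat_into C j = ball c (1 / Suc n)"
        unfolding j_def using count c by (intro from_nat_into_to_nat_on) (auto simp: C_def)
      have "j \<in> I" unfolding I_def j_def using c by auto
      then have "j < Suc (Max I)" using fin by (simp add: le_imp_less_Suc)
      then have "y \<in> ball c (1 / Suc n)" using * c j by metis
      then have "dist c x < 1 / Suc n" "dist c y < 1 / Suc n" using c by auto
      then show ?thesis using n dist_triangle3[of x y c] by linarith
    qed
    then show ?thesis by blast
  qed
  then show thesis by (rule that)
qed

text \<open>Digits 0 and 1 in base 3: up to the factor 2/3 this is the usual coding of the Cantor
  set. Base 2 would not do, since there distinct digit sequences can have the same value.\<close>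

definition ternary :: "(nat \<Rightarrow> bool) \<Rightarrow> real"
  where "ternary b = (\<Sum>j. of_bool (b j) * (1/3) ^ j)"

lemma summable_ternary: "summable (\<lambda>j. of_bool (b j) * (1/3::real) ^ j)"
  by (rule summable_comparison_test[of _ "\<lambda>j. (1/3) ^ j"]) (auto intro!: exI[of _ 0])

text \<open>The first differing digit contributes (1/3)^m, and all later digits of \<open>c\<close>
  together can recover at most half of it.\<close>

lemma ternary_first_difference:
  assumes "\<And>j. j < m \<Longrightarrow> b j = c j" "b m" "\<not> c m"
  shows "ternary b - ternary c \<ge> (1/3) ^ m / 2"
proof -
  have geo: "(\<lambda>j. (1/3::real) ^ (j + Suc m)) sums ((1/3) ^ m / 2)"
    using sums_mult[OF geometric_sums[of "1/3::real"], of "(1/3) ^ Suc m"]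
    by (simp add: power_add mult_ac)
  have split: "ternary d = (\<Sum>j<m. of_bool (d j) * (1/3) ^ j) + of_bool (d m) * (1/3) ^ m
      + (\<Sum>j. of_bool (d (j + Suc m)) * (1/3) ^ (j + Suc m))" for d
    unfolding ternary_def
    using suminf_split_initial_segment[OF summable_ternary, of d "Suc m"] by simp
  have sm: "summable (\<lambda>j. of_bool (d (j + Suc m)) * (1/3::real) ^ (j + Suc m))" for d
    using summable_ignore_initial_segment[OF summable_ternary[of d], of "Suc m"] .
  have "0 \<le> (\<Sum>j. of_bool (b (j + Suc m)) * (1/3::real) ^ (j + Suc m))"
    by (rule suminf_nonneg[OF sm]) auto
  moreover have "(\<Sum>j. of_bool (c (j + Suc m)) * (1/3::real) ^ (j + Suc m)) \<le> (1/3) ^ m / 2"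
    unfolding sums_unique[OF geo]
    by (rule suminf_le[OF _ sm sums_summable[OF geo]]) auto
  moreover have "(\<Sum>j<m. of_bool (b j) * (1/3::real) ^ j) = (\<Sum>j<m. of_bool (c j) * (1/3) ^ j)"
    using assms by (intro sum.cong) auto
  ultimately show ?thesis
    using split[of b] split[of c] assms by (simp del: power_Suc add_Suc_right)
qed

lemma ternary_close_imp_agree:
  assumes "\<bar>ternary b - ternary c\<bar> < (1/3) ^ M / 2" "j < M"
  shows "b j = c j"
proof (rule ccontr)
  assume ne: "b j \<noteq> c j"
  define m where "m = (LEAST i. b i \<noteq> c i)"
  have m: "b m \<noteq> c m" "\<And>i. i < m \<Longrightarrow> b i = c i" "m \<le> j"
    unfolding m_def using LeastI[of "\<lambda>i. b i \<noteq> c i", OF ne] not_less_Least[of _ "\<lambda>i. b i \<noteq> c i"]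
      Least_le[of "\<lambda>i. b i \<noteq> c i", OF ne] by blast+
  have "(1/3::real) ^ M \<le> (1/3) ^ m" using m assms(2) by (intro power_decreasing) auto
  moreover have "\<bar>ternary b - ternary c\<bar> \<ge> (1/3) ^ m / 2"
  proof (cases "b m")
    case True
    then have "ternary b - ternary c \<ge> (1/3) ^ m / 2"
      using m(1,2) by (intro ternary_first_difference) auto
    then show ?thesis by linarith
  next
    case False
    then have "ternary c - ternary b \<ge> (1/3) ^ m / 2"
      using m(1,2) by (intro ternary_first_difference) auto
    then show ?thesis by linarith
  qed
  ultimately show False using assms(1) by linarith
qed

text \<open>The code \<open>e\<close> may well be discontinuous, but nearby codes agree in many
  digits and so come from nearby points. Hence the inverse of \<open>e\<close> is uniformly
  continuous on the range of \<open>e\<close> and extends to the closure \<open>K\<close> by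
  completeness; \<open>\<pi>\<close> is this extension and \<open>e\<close> a section of it.\<close>

lemma compact_metric_real_quotient:
  assumes cpt: "compact (UNIV :: 'a::metric_space set)"
  obtains K :: "real set" and e :: "'a::metric_space \<Rightarrow> real" and \<pi> :: "real \<Rightarrow> 'a"
  where "compact K" "continuous_on K \<pi>" "\<And>x. e x \<in> K" "\<And>x. \<pi> (e x) = x"
proof -
  obtain U :: "nat \<Rightarrow> 'a set"
    where U: "\<And>\<epsilon>::real. \<epsilon> > 0 \<Longrightarrow> \<exists>M. \<forall>x y. (\<forall>j<M. x \<in> U j \<longleftrightarrow> y \<in> U j) \<longrightarrow> dist x y < \<epsilon>"
    using separating_sequence[OF cpt] by blast
  define e where "e x = ternary (\<lambda>j. x \<in> U j)" for x
  have e: "\<exists>\<delta>>0. \<forall>x y. \<bar>e x - e y\<bar> < \<delta> \<longrightarrow> dist x y < \<epsilon>" if "\<epsilon> > 0" for \<epsilon> :: real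
  proof -
    obtain M where M: "\<forall>x y. (\<forall>j<M. x \<in> U j \<longleftrightarrow> y \<in> U j) \<longrightarrow> dist x y < \<epsilon>" using U \<open>\<epsilon> > 0\<close> by blast
    have "dist x y < \<epsilon>" if "\<bar>e x - e y\<bar> < (1/3) ^ M / 2" for x y
      using M ternary_close_imp_agree[OF that[unfolded e_def]] by blast
    then show ?thesis by (intro exI[of _ "(1/3)^M/2"]) auto
  qed
  define K where "K = closure (range e)"
  have "\<bar>e x\<bar> \<le> 3/2" for x
  proof -
    have *: "(\<lambda>j. (1/3::real) ^ j) sums (3/2)" using geometric_sums[of "1/3::real"] by simp
    have "\<And>b. ternary b \<le> 3/2"
    proof -
      fix b
      show "ternary b \<le> 3/2"
        unfolding ternary_def sums_unique[OF *]
        by (rule suminf_le[OF _ summable_ternary sums_summable[OF *]]) auto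
    qed
    moreover have "0 \<le> ternary b" for b
      unfolding ternary_def by (rule suminf_nonneg[OF summable_ternary]) auto
    ultimately show ?thesis by (simp add: e_def)
  qed
  then have "bounded (range e)" unfolding bounded_iff by (intro exI[of _ "3/2"]) auto
  then have K: "compact K" unfolding K_def by (simp add: compact_closure)
  \<comment> \<open>\<open>P\<close> is the closure of the graph of the inverse of \<open>e\<close>.
    By \<open>uc\<close>, points related to nearby reals are close, so an arbitrary selection
    \<open>\<pi>\<close> from \<open>P\<close> is uniformly continuous on \<open>K\<close>.\<close>
  define P where "P t x \<longleftrightarrow> (\<exists>s. (\<lambda>n. e (s n)) \<longlonglongrightarrow> t \<and> s \<longlonglongrightarrow> x)" for t x
  have ex: "\<exists>x. P t x" if tK: "t \<in> K" for t
  proof -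
    obtain y where y: "\<And>n. y n \<in> range e" "y \<longlonglongrightarrow> t" using tK unfolding K_def closure_sequential by blast
    then have "\<forall>n. \<exists>x. y n = e x" by auto
    then obtain s where s: "\<And>n. y n = e (s n)" by metis
    have "Cauchy s"
    proof (rule metric_CauchyI)
      fix \<epsilon> :: real assume "\<epsilon> > 0"
      then obtain \<delta> where d: "\<delta> > 0" "\<And>x y. \<bar>e x - e y\<bar> < \<delta> \<Longrightarrow> dist x y < \<epsilon>" using e by blast
      have "Cauchy y" using y(2) by (rule LIMSEQ_imp_Cauchy)
      from metric_CauchyD[OF this d(1)] show "\<exists>M. \<forall>m\<ge>M. \<forall>n\<ge>M. dist (s m) (s n) < \<epsilon>"
        using d(2) by (simp add: s dist_real_def) blast
    qed
    then obtain x where "s \<longlonglongrightarrow> x" using compact_imp_complete[OF cpt] by (auto simp: complete_def)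
    moreover have "y = (\<lambda>n. e (s n))" using s by (rule ext)
    ultimately show ?thesis unfolding P_def using y(2) by blast
  qed
  have uc: "\<exists>\<delta>>0. \<forall>t t' x x'. P t x \<longrightarrow> P t' x' \<longrightarrow> \<bar>t - t'\<bar> < \<delta> \<longrightarrow> dist x x' \<le> \<epsilon>" if pos: "\<epsilon> > 0" for \<epsilon> :: real
  proof -
    obtain \<delta> where d: "\<delta> > 0" "\<And>x y. \<bar>e x - e y\<bar> < \<delta> \<Longrightarrow> dist x y < \<epsilon>" using e pos by blast
    have "dist x x' \<le> \<epsilon>" if tt: "P t x" "P t' x'" "\<bar>t - t'\<bar> < \<delta>" for t t' x x'
    proof -
      obtain s s' where s: "(\<lambda>n. e (s n)) \<longlonglongrightarrow> t" "s \<longlonglongrightarrow> x" "(\<lambda>n. e (s' n)) \<longlonglongrightarrow> t'" "s' \<longlonglongrightarrow> x'"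
        using tt unfolding P_def by blast
      have "(\<lambda>n. \<bar>e (s n) - e (s' n)\<bar>) \<longlonglongrightarrow> \<bar>t - t'\<bar>" by (intro tendsto_intros s)
      then have "\<forall>\<^sub>F n in sequentially. \<bar>e (s n) - e (s' n)\<bar> < \<delta>" by (rule order_tendstoD) (rule tt)
      then have "\<forall>\<^sub>F n in sequentially. dist (s n) (s' n) \<le> \<epsilon>"
        by eventually_elim (use d(2) in force)
      moreover have "(\<lambda>n. dist (s n) (s' n)) \<longlonglongrightarrow> dist x x'" by (intro tendsto_intros s)
      ultimately show ?thesis by (intro tendsto_upperbound) auto
    qed
    then show ?thesis using d(1) by blast
  qed
  define \<pi> where "\<pi> t = (SOME x. P t x)" for t
  have \<pi>: "P t (\<pi> t)" if "t \<in> K" for t unfolding \<pi>_def using someI_ex[OF ex[OF that]] .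
  have "continuous_on K \<pi>"
    unfolding continuous_on_iff
  proof (intro ballI allI impI)
    fix t and \<epsilon> :: real assume t: "t \<in> K" "\<epsilon> > 0"
    obtain \<delta> where d: "\<delta>>0" "\<forall>t t' x x'. P t x \<longrightarrow> P t' x' \<longrightarrow> \<bar>t - t'\<bar> < \<delta> \<longrightarrow> dist x x' \<le> \<epsilon>/2"
      using uc[of "\<epsilon>/2"] t by auto
    then have "dist (\<pi> t') (\<pi> t) \<le> \<epsilon>/2" if "t' \<in> K" "dist t' t < \<delta>" for t'
      using \<pi>[OF that(1)] \<pi>[OF t(1)] that(2) by (auto simp: dist_real_def)
    then show "\<exists>d>0. \<forall>x'\<in>K. dist x' t < d \<longrightarrow> dist (\<pi> x') (\<pi> t) < \<epsilon>"
      using d(1) t(2) by (intro exI[of _ \<delta>]) force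
  qed
  moreover have eK: "e x \<in> K" for x unfolding K_def using closure_subset[of "range e"] by auto
  moreover have "\<pi> (e x) = x" for x
  proof (rule ccontr)
    assume "\<pi> (e x) \<noteq> x"
    then have pos: "dist (\<pi> (e x)) x / 2 > 0" by simp
    have "P (e x) x" unfolding P_def by (rule exI[of _ "\<lambda>_. x"]) auto
    \<comment> \<open>Equal codes satisfy the closeness condition of \<open>uc\<close> for every
      \<delta>, so the distance is at most half of itself.\<close>
    then have "dist (\<pi> (e x)) x \<le> dist (\<pi> (e x)) x / 2"
      using uc[OF pos] \<pi>[OF eK[of x]] by (metis abs_zero diff_self)
    then show False using pos by simp
  qed
  ultimately show thesis using that K by blast
qed

text \<open>The codes of the points \<open>y i\<close> stay in the compact set \<open>K\<close>, so
  their empirical measures on the line are tight and have a weak limit \<open>M\<close> along a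
  subsequence of \<open>r\<close>. The image of \<open>M\<close> under \<open>\<pi>\<close> is the
  limit on the original space, because \<open>\<pi>\<close> decodes \<open>e\<close>.\<close>

lemma weak_star_subsequence:
  fixes y :: "nat \<Rightarrow> 'a::metric_space" and r :: "nat \<Rightarrow> nat"
  assumes cpt: "compact (UNIV :: 'a set)" and r: "strict_mono r"
  obtains s \<mu> where "strict_mono (s :: nat \<Rightarrow> nat)" "prob_space \<mu>" "sets \<mu> = sets borel"
    "\<And>h :: 'a \<Rightarrow> real. continuous_on UNIV h \<Longrightarrow>
      (\<lambda>k. (\<Sum>i<r (s k). h (y i)) / real (r (s k))) \<longlonglongrightarrow> (\<integral>x. h x \<partial>\<mu>)"
proof -
  obtain K :: "real set" and e :: "'a \<Rightarrow> real" and \<pi> :: "real \<Rightarrow> 'a"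
    where K: "compact K" "continuous_on K \<pi>" "\<And>x. e x \<in> K" "\<And>x. \<pi> (e x) = x"
    using compact_metric_real_quotient[OF cpt] by metis
  \<comment> \<open>For \<open>n\<close> = 0 truncated subtraction leaves the single index 0, so
    every \<open>\<nu> n\<close> is a probability measure. This explains the denominator
    \<open>Suc (n - 1)\<close> in \<open>int\<close>, which equals \<open>n\<close> once
    \<open>n\<close> is positive.\<close>
  define \<nu> where "\<nu> n = distr (measure_pmf (pmf_of_set {..n-1})) borel (\<lambda>i. e (y i))" for n :: nat
  have rd: "real_distribution (\<nu> n)" for n unfolding \<nu>_def
    by (intro prob_space.real_distribution_distr measure_pmf.prob_space_axioms) auto
  have int: "(\<integral>t. g t \<partial>\<nu> n) = (\<Sum>i\<le>n-1. g (e (y i))) / real (Suc (n - 1))"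
    if "g \<in> borel_measurable borel" for n and g :: "real \<Rightarrow> real"
    unfolding \<nu>_def using that by (simp add: integral_distr integral_pmf_of_set)
  obtain B where B: "B > 0" "\<And>t. t \<in> K \<Longrightarrow> \<bar>t\<bar> < B"
    using compact_imp_bounded[OF K(1)] unfolding bounded_pos_less by auto
  have "tight \<nu>" unfolding tight_def
  proof (intro conjI allI impI rd)
    fix \<epsilon> :: real assume "\<epsilon> > 0"
    have "-B < e x \<and> e x \<le> B" for x using B(2)[OF K(3)[of x]] by auto
    then have "(\<lambda>i. e (y i)) -` {-B<..B} = UNIV" by auto
    then have "measure (\<nu> n) {-B<..B} = 1" for n unfolding \<nu>_def
      by (subst measure_distr) (auto simp: measure_pmf.prob_space[simplified])
    then show "\<exists>a b. a < b \<and> (\<forall>n. 1 - \<epsilon> < measure (\<nu> n) {a<..b})"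
      using \<open>\<epsilon> > 0\<close> B(1) by (intro exI[of _ "-B"] exI[of _ B]) auto
  qed
  from tight_imp_convergent_subsubsequence[OF this r] obtain s M
    where s: "strict_mono s" and M: "real_distribution M" and conv: "weak_conv_m (\<nu> \<circ> r \<circ> s) M" by blast
  interpret M: real_distribution M by fact
  have lim: "(\<lambda>k. \<integral>t. g t \<partial>\<nu> (r (s k))) \<longlonglongrightarrow> (\<integral>t. g t \<partial>M)"
    if "continuous_on UNIV g" "\<And>t. \<bar>g t\<bar> \<le> C" for g :: "real \<Rightarrow> real" and C
  proof -
    have "(\<lambda>n. integral\<^sup>L ((\<nu> \<circ> r \<circ> s) n) g) \<longlonglongrightarrow> integral\<^sup>L M g"
      by (rule weak_conv_imp_integral_bdd_continuous_conv[OF _ M conv, of _ C])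
        (use rd that in \<open>auto simp: continuous_on_eq_continuous_at\<close>)
    then show ?thesis by simp
  qed
  have AEK: "AE t in M. t \<in> K"
  proof -
    \<comment> \<open>A bounded continuous function that vanishes exactly on \<open>K\<close>: its
      integrals against all \<open>\<nu> n\<close> are 0, hence so is the one against
      \<open>M\<close>.\<close>
    define g where "g t = min 1 (infdist t K)" for t
    have cg: "continuous_on UNIV g" unfolding g_def by (intro continuous_intros)
    have g: "0 \<le> g t" "\<bar>g t\<bar> \<le> 1" "g t \<le> 1" for t unfolding g_def by (auto simp: infdist_nonneg)
    have mg[measurable]: "g \<in> borel_measurable borel" using cg by (rule borel_measurable_continuous_onI)
    have "g (e x) = 0" for x using K(3) by (simp add: g_def)
    then have "(\<integral>t. g t \<partial>\<nu> n) = 0" for n using int[OF mg] by simp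
    then have "(\<integral>t. g t \<partial>M) = 0" using lim[OF cg g(2)] by (simp add: LIMSEQ_const_iff)
    then have "AE t in M. g t = 0"
      by (subst (asm) integral_nonneg_eq_0_iff_AE)
        (auto intro!: M.integrable_const_bound[of _ 1] simp: g)
    moreover have "t \<in> K" if "g t = 0" for t
    proof -
      have "infdist t K = 0" using that by (auto simp: g_def min_def split: if_splits)
      then show ?thesis using in_closed_iff_infdist_zero[of K t] K(1,3) compact_imp_closed by blast
    qed
    ultimately show ?thesis by (auto elim: AE_mp)
  qed
  have [measurable]: "K \<in> sets borel" using K(1) by (simp add: borel_compact)
  \<comment> \<open>\<open>\<pi>\<close> is continuous only on \<open>K\<close>; a constant value
    elsewhere gives a Borel map, and by \<open>AEK\<close> this changes no integral against
    \<open>M\<close>.\<close>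
  define \<pi>' where "\<pi>' t = (if t \<in> K then \<pi> t else undefined)" for t
  have \<pi>'[measurable]: "\<pi>' \<in> borel_measurable borel"
    unfolding \<pi>'_def by (intro borel_measurable_continuous_on_if K) auto
  define \<mu> where "\<mu> = distr M borel \<pi>'"
  have mu: "prob_space \<mu>" unfolding \<mu>_def by (rule M.prob_space_distr) simp
  have smu: "sets \<mu> = sets borel" by (simp add: \<mu>_def)
  have "(\<lambda>k. (\<Sum>i<r (s k). h (y i)) / real (r (s k))) \<longlonglongrightarrow> (\<integral>x. h x \<partial>\<mu>)"
    if h: "continuous_on UNIV h" for h :: "'a \<Rightarrow> real"
  proof -
    have mh[measurable]: "h \<in> borel_measurable borel" using h by (rule borel_measurable_continuous_onI)
    have "bounded (range h)" using compact_continuous_image[OF h cpt] compact_imp_bounded by blast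
    then obtain C where C: "C > 0" "\<And>x. \<bar>h x\<bar> \<le> C" unfolding bounded_pos by auto
    have "continuous_on K (h \<circ> \<pi>)"
      by (intro continuous_on_compose K continuous_on_subset[OF h]) auto
    \<comment> \<open>The extension keeps the bound \<open>C\<close>, so \<open>g\<close> is an
      admissible test function for weak convergence on the whole line.\<close>
    then obtain g where g: "continuous_on UNIV g" "\<And>t. t \<in> K \<Longrightarrow> g t = (h \<circ> \<pi>) t" "\<And>t. norm (g t) \<le> C"
      using Tietze[of K "h \<circ> \<pi>" UNIV C] C K(1) by (auto simp: compact_imp_closed)
    have mg[measurable]: "g \<in> borel_measurable borel" using g(1) by (rule borel_measurable_continuous_onI)
    have ge: "g (e x) = h x" for x using g(2) K(3,4) by auto
    have "(\<integral>x. h x \<partial>\<mu>) = (\<integral>t. h (\<pi>' t) \<partial>M)" unfolding \<mu>_def by (rule integral_distr) auto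
    also have "\<dots> = (\<integral>t. g t \<partial>M)"
    proof (rule integral_cong_AE)
      show "(\<lambda>t. h (\<pi>' t)) \<in> borel_measurable M" using measurable_compose[OF \<pi>' mh] by simp
      show "AE t in M. h (\<pi>' t) = g t" using AEK by eventually_elim (simp add: \<pi>'_def g(2))
    qed simp
    finally have eq: "(\<integral>x. h x \<partial>\<mu>) = (\<integral>t. g t \<partial>M)" .
    have "(\<lambda>k. \<integral>t. g t \<partial>\<nu> (r (s k))) \<longlonglongrightarrow> (\<integral>x. h x \<partial>\<mu>)"
      unfolding eq by (rule lim[of g C]) (use g in auto)
    moreover have "(\<integral>t. g t \<partial>\<nu> (r (s k))) = (\<Sum>i<r (s k). h (y i)) / real (r (s k))" if k1: "k \<ge> 1" for k
    proof -
      have "strict_mono (r \<circ> s)" using r s by (simp add: strict_mono_o)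
      then have "k \<le> r (s k)" using seq_suble[of "r \<circ> s" k] by simp
      with k1 obtain n where n: "r (s k) = Suc n" by (cases "r (s k)") auto
      show ?thesis unfolding int[OF mg] n by (simp add: ge lessThan_Suc_atMost)
    qed
    then have "\<forall>\<^sub>F k in sequentially. (\<integral>t. g t \<partial>\<nu> (r (s k))) = (\<Sum>i<r (s k). h (y i)) / real (r (s k))"
      unfolding eventually_sequentially by blast
    ultimately show ?thesis by (rule Lim_transform_eventually)
  qed
  then show thesis using that[OF s mu smu] by blast
qed

section \<open>Invariant measures and asymptotically additive potentials\<close>

text \<open>Closed sets form an intersection-stable generator of the Borel sets, and the indicator
  of a nonempty closed set is the pointwise limit of the continuous functions \<open>h n\<close>, so
  dominated convergence recovers its measure from integrals.\<close>

lemma measure_eqI_continuous: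
  fixes \<mu> \<nu> :: "'a::metric_space measure"
  assumes \<mu>: "prob_space \<mu>" "sets \<mu> = sets borel" and \<nu>: "prob_space \<nu>" "sets \<nu> = sets borel"
    and eq: "\<And>h. continuous_on UNIV h \<Longrightarrow> (\<And>x. 0 \<le> h x \<and> h x \<le> 1) \<Longrightarrow> (\<integral>x. h x \<partial>\<mu>) = (\<integral>x. h x \<partial>\<nu> :: real)"
  shows "\<mu> = \<nu>"
proof -
  interpret \<mu>: prob_space \<mu> by fact
  interpret \<nu>: prob_space \<nu> by fact
  have closed_eq: "emeasure \<mu> C = emeasure \<nu> C" if C: "closed C" for C
  \<comment> \<open>By convention \<open>infdist\<close> to the empty set is 0, which would make
    every \<open>h n\<close> constantly 1.\<close>
  proof (cases "C = {}")
    case False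
    define h where "h n x = max 0 (1 - real n * infdist x C)" for n x
    have ch: "continuous_on UNIV (h n)" for n unfolding h_def by (intro continuous_intros)
    have h01: "0 \<le> h n x \<and> h n x \<le> 1" for n x unfolding h_def by (auto simp: infdist_nonneg)
    have hlim: "(\<lambda>n. h n x) \<longlonglongrightarrow> indicator C x" for x
    proof (cases "x \<in> C")
      case True
      then show ?thesis by (simp add: h_def)
    next
      case out: False
      then have "infdist x C > 0" using infdist_pos_not_in_closed[OF C False] by auto
      then obtain N :: nat where N: "1 < real N * infdist x C" using reals_Archimedean3 by blast
      have "h n x = 0" if "n \<ge> N" for n
      proof -
        have "real N * infdist x C \<le> real n * infdist x C"
          using that \<open>infdist x C > 0\<close> by (intro mult_right_mono) auto
        then show ?thesis using N by (simp add: h_def)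
      qed
      then have "\<forall>\<^sub>F n in sequentially. h n x = indicator C x"
        unfolding eventually_sequentially using out by (intro exI[of _ N]) auto
      then show ?thesis by (rule tendsto_eventually)
    qed
    have lim: "(\<lambda>n. \<integral>x. h n x \<partial>M) \<longlonglongrightarrow> measure M C" if M: "prob_space M" "sets M = sets borel" for M
    proof -
      interpret prob_space M by (rule M)
      have hm: "h n \<in> borel_measurable M" for n
        using borel_measurable_continuous_onI[OF ch[of n]] measurable_cong_sets[OF M(2) refl] by blast
      have Cm: "C \<in> sets M" using C M(2) by simp
      have "(\<lambda>n. \<integral>x. h n x \<partial>M) \<longlonglongrightarrow> (\<integral>x. indicator C x \<partial>M)"
        by (rule integral_dominated_convergence[where w="\<lambda>_. 1"]) (use hm Cm hlim h01 in auto)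
      then show ?thesis using Cm by simp
    qed
    have "measure \<mu> C = measure \<nu> C"
      using lim[OF \<mu>] lim[OF \<nu>] eq[OF ch h01] LIMSEQ_unique by simp
    then show ?thesis by (simp add: \<mu>.emeasure_eq_measure \<nu>.emeasure_eq_measure)
  qed simp
  have "sets (borel :: 'a measure) = sigma_sets UNIV (Collect closed)"
    unfolding borel_eq_closed by (rule sets_measure_of) auto
  then show ?thesis
    by (intro measure_eqI_generator_eq[of "Collect closed" UNIV \<mu> \<nu> "\<lambda>_. UNIV"])
      (use \<mu>(2) \<nu>(2) closed_eq in \<open>auto simp: Int_stable_def\<close>)
qed

section \<open>Birkhoff sums, invariance and limit measures on a compact space\<close>

locale compact_dynamics =
  fixes T :: "'a::metric_space \<Rightarrow> 'a"
  assumes compact_space: "compact (UNIV :: 'a set)"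
    and continuous_map: "continuous_on UNIV T"
begin

lemma continuous_bounded:
  fixes h :: "'a \<Rightarrow> real"
  assumes "continuous_on UNIV h"
  obtains C where "C > 0" "\<And>x. \<bar>h x\<bar> \<le> C"
proof -
  have "bounded (range h)" using compact_continuous_image[OF assms compact_space] compact_imp_bounded by blast
  then show thesis using that unfolding bounded_pos by auto
qed

lemma continuous_iterate: "continuous_on UNIV (T ^^ n)"
proof (induction n)
  case (Suc n)
  then show ?case unfolding funpow.simps
    by (rule continuous_on_compose[OF _ continuous_on_subset[OF continuous_map]]) simp
qed (simp add: id_def)

lemma continuous_birk:
  assumes "continuous_on UNIV h"
  shows "continuous_on UNIV (birk T h n)"
  unfolding birk_def[abs_def]
  by (intro continuous_on_sum continuous_on_compose2[OF assms continuous_iterate]) auto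

lemma borel_measurable_continuous:
  fixes h :: "'a \<Rightarrow> real"
  assumes "sets \<mu> = sets borel" "continuous_on UNIV h"
  shows "h \<in> borel_measurable \<mu>"
  using borel_measurable_continuous_onI[OF assms(2)] measurable_cong_sets[OF assms(1) refl] by blast

lemma integrable_continuous:
  fixes h :: "'a \<Rightarrow> real"
  assumes "prob_space \<mu>" "sets \<mu> = sets borel" "continuous_on UNIV h"
  shows "integrable \<mu> h"
proof -
  interpret prob_space \<mu> by fact
  obtain C where "\<And>x. \<bar>h x\<bar> \<le> C" using continuous_bounded[OF assms(3)] by blast
  then show ?thesis
    by (intro integrable_const_bound[of _ C] borel_measurable_continuous assms) auto
qed

lemma integral_iterate:
  fixes h :: "'a \<Rightarrow> real"
  assumes \<mu>: "\<mu> \<in> invariant_measures T" and h: "continuous_on UNIV h"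
  shows "(\<integral>x. h ((T ^^ n) x) \<partial>\<mu>) = (\<integral>x. h x \<partial>\<mu>)"
  using h
proof (induction n arbitrary: h)
  case (Suc n)
  have smu: "sets \<mu> = sets borel" using \<mu> by (simp add: invariant_measures_def)
  have space: "space \<mu> = UNIV" using sets_eq_imp_space_eq[OF smu] by simp
  have Tm: "T \<in> measurable \<mu> borel"
    using borel_measurable_continuous_onI[OF continuous_map] measurable_cong_sets[OF smu refl] by blast
  have "distr \<mu> borel T = \<mu>"
  proof (rule measure_eqI)
    fix A assume "A \<in> sets (distr \<mu> borel T)"
    then have A: "A \<in> sets borel" by simp
    show "emeasure (distr \<mu> borel T) A = emeasure \<mu> A"
      using \<mu> A by (simp add: emeasure_distr[OF Tm A] space invariant_measures_def)
  qed (simp add: smu)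
  then have "(\<integral>x. h x \<partial>\<mu>) = (\<integral>x. h (T x) \<partial>\<mu>)"
    using integral_distr[OF Tm, of h] borel_measurable_continuous_onI[OF Suc.prems] by simp
  moreover have "continuous_on UNIV (\<lambda>x. h (T x))"
    by (rule continuous_on_compose2[OF Suc.prems continuous_map]) auto
  ultimately show ?case using Suc.IH[of "\<lambda>x. h (T x)"] by simp
qed simp

lemma integral_birk:
  assumes \<mu>: "\<mu> \<in> invariant_measures T" and h: "continuous_on UNIV h"
  shows "(\<integral>x. birk T h n x \<partial>\<mu>) = real n * (\<integral>x. h x \<partial>\<mu>)"
proof -
  have p: "prob_space \<mu>" "sets \<mu> = sets borel" using \<mu> by (simp_all add: invariant_measures_def)
  have "integrable \<mu> (\<lambda>x. h ((T ^^ i) x))" for i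
    by (intro integrable_continuous p continuous_on_compose2[OF h continuous_iterate]) auto
  then show ?thesis unfolding birk_def by (simp add: integral_iterate[OF \<mu> h])
qed

text \<open>The Birkhoff sums of h and of its composition with T telescope: they differ by at most
  \<open>2 * C\<close> whatever their length, so the averages have the same limit. Thus \<mu> and
  its image under T agree on continuous functions.\<close>

lemma empirical_limit_invariant:
  assumes "\<mu> \<in> empirical_limits T x"
  shows "\<mu> \<in> invariant_measures T"
proof -
  obtain r where p: "prob_space \<mu>" "sets \<mu> = sets borel" and r: "strict_mono r"
    and lim: "\<And>h. continuous_on UNIV h \<Longrightarrow> (\<lambda>k. birk T h (r k) x / real (r k)) \<longlonglongrightarrow> (\<integral>y. h y \<partial>\<mu>)"
    using assms unfolding empirical_limits_def by blast
  have space: "space \<mu> = UNIV" using sets_eq_imp_space_eq[OF p(2)] by simp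
  have Tm: "T \<in> measurable \<mu> borel"
    using borel_measurable_continuous_onI[OF continuous_map] measurable_cong_sets[OF p(2) refl] by blast
  have "(\<integral>y. h (T y) \<partial>\<mu>) = (\<integral>y. h y \<partial>\<mu>)" if h: "continuous_on UNIV h" for h :: "'a \<Rightarrow> real"
  proof -
    obtain C where C: "C > 0" "\<And>x. \<bar>h x\<bar> \<le> C" using continuous_bounded[OF h] by blast
    have hT: "continuous_on UNIV (\<lambda>y. h (T y))"
      by (rule continuous_on_compose2[OF h continuous_map]) auto
    have telescope: "birk T (\<lambda>y. h (T y)) n x - birk T h n x = h ((T ^^ n) x) - h x" for n
      unfolding birk_def by (induction n) auto
    have null: "(\<lambda>k. 2 * C / real (r k)) \<longlonglongrightarrow> 0"
      by (intro tendsto_divide_0[OF tendsto_const] filterlim_at_top_imp_at_infinity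
          filterlim_compose[OF filterlim_real_sequentially] filterlim_subseq r)
    have bound: "norm (birk T (\<lambda>y. h (T y)) (r k) x / real (r k) - birk T h (r k) x / real (r k))
        \<le> 2 * C / real (r k)" for k
    proof -
      have "\<bar>h ((T ^^ r k) x) - h x\<bar> \<le> 2 * C" using C(2)[of x] C(2)[of "(T ^^ r k) x"] by linarith
      then show ?thesis unfolding diff_divide_distrib[symmetric] telescope
        by (simp add: divide_right_mono)
    qed
    have "(\<lambda>k. birk T (\<lambda>y. h (T y)) (r k) x / real (r k) - birk T h (r k) x / real (r k)) \<longlonglongrightarrow> 0"
      by (rule Lim_null_comparison[OF always_eventually null]) (use bound in blast)
    moreover have "(\<lambda>k. birk T (\<lambda>y. h (T y)) (r k) x / real (r k) - birk T h (r k) x / real (r k))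
        \<longlonglongrightarrow> (\<integral>y. h (T y) \<partial>\<mu>) - (\<integral>y. h y \<partial>\<mu>)"
      by (intro tendsto_diff lim h hT)
    ultimately show ?thesis using LIMSEQ_unique by force
  qed
  then have "distr \<mu> borel T = \<mu>"
    by (intro measure_eqI_continuous prob_space.prob_space_distr p Tm)
      (auto simp: integral_distr Tm borel_measurable_continuous_onI)
  then have "emeasure \<mu> (T -` A) = emeasure \<mu> A" if "A \<in> sets borel" for A
    using emeasure_distr[OF Tm that] space by simp
  then show ?thesis using p by (simp add: invariant_measures_def)
qed

section \<open>Asymptotically additive potentials and their integrals\<close>

lemma AAP_approx:
  assumes f: "AAP T f" and "\<xi> > 0"
  obtains h where "continuous_on UNIV h" "\<forall>\<^sub>F n in sequentially. \<forall>x. \<bar>f n x - birk T h n x\<bar> \<le> \<xi> * real n"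
proof -
  obtain h where h: "continuous_on UNIV h"
    and lim: "limsup (\<lambda>n. ereal ((SUP x. \<bar>f n x - birk T h n x\<bar>) / real n)) < ereal \<xi>"
    using f \<open>\<xi> > 0\<close> unfolding AAP_def by blast
  have "\<forall>\<^sub>F n in sequentially. \<forall>x. \<bar>f n x - birk T h n x\<bar> \<le> \<xi> * real n"
    using Limsup_lessD[OF lim] eventually_ge_at_top[of 1]
  proof eventually_elim
    case (elim n)
    \<comment> \<open>A real supremum bounds the values only if these are bounded above. Compactness
      supplies this for \<open>n\<close> at least 1, where \<open>f n\<close> is continuous.\<close>
    have "continuous_on UNIV (\<lambda>x. \<bar>f n x - birk T h n x\<bar>)"
      using f elim(2) by (intro continuous_intros continuous_birk h) (simp add: AAP_def)
    then obtain C where C: "\<And>x. \<bar>\<bar>f n x - birk T h n x\<bar>\<bar> \<le> C" using continuous_bounded by blast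
    then have bdd: "bdd_above (range (\<lambda>x. \<bar>f n x - birk T h n x\<bar>))" by (intro bdd_aboveI[of _ C]) auto
    have "(SUP x. \<bar>f n x - birk T h n x\<bar>) \<le> \<xi> * real n"
      using elim by (simp add: divide_less_eq)
    then show ?case using cSUP_upper[OF _ bdd] by (meson UNIV_I order_trans)
  qed
  then show thesis using that h by blast
qed

lemma AAP_integral_close:
  assumes f: "AAP T f" and \<mu>: "\<mu> \<in> invariant_measures T" and h: "continuous_on UNIV h"
    and ev: "\<forall>\<^sub>F n in sequentially. \<forall>x. \<bar>f n x - birk T h n x\<bar> \<le> \<xi> * real n"
  shows "\<forall>\<^sub>F n in sequentially. \<bar>(\<integral>x. f n x \<partial>\<mu>) / real n - (\<integral>x. h x \<partial>\<mu>)\<bar> \<le> \<xi>"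
  using ev eventually_ge_at_top[of 1]
proof eventually_elim
  case (elim n)
  have p: "prob_space \<mu>" "sets \<mu> = sets borel" using \<mu> by (simp_all add: invariant_measures_def)
  interpret prob_space \<mu> by fact
  have i: "integrable \<mu> (f n)" "integrable \<mu> (birk T h n)"
    using f elim(2) by (auto intro!: integrable_continuous p continuous_birk h simp: AAP_def)
  have "(\<integral>x. f n x \<partial>\<mu>) - real n * (\<integral>x. h x \<partial>\<mu>) = (\<integral>x. f n x - birk T h n x \<partial>\<mu>)"
    using i by (simp add: integral_birk[OF \<mu> h])
  also have "\<bar>\<dots>\<bar> \<le> (\<integral>x. \<bar>f n x - birk T h n x\<bar> \<partial>\<mu>)"
    using integral_norm_bound[of \<mu> "\<lambda>x. f n x - birk T h n x"] by simp
  also have "\<dots> \<le> (\<integral>x. \<xi> * real n \<partial>\<mu>)"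
    using i elim(1) by (intro integral_mono) auto
  also have "\<dots> = \<xi> * real n" by (simp add: prob_space)
  finally have "\<bar>(\<integral>x. f n x \<partial>\<mu>) - real n * (\<integral>x. h x \<partial>\<mu>)\<bar> / real n \<le> \<xi>"
    using elim(2) by (simp add: divide_le_eq)
  moreover have "(\<integral>x. f n x \<partial>\<mu>) / real n - (\<integral>x. h x \<partial>\<mu>) = ((\<integral>x. f n x \<partial>\<mu>) - real n * (\<integral>x. h x \<partial>\<mu>)) / real n"
    using elim(2) by (simp add: field_simps)
  ultimately show ?case by simp
qed

text \<open>\<open>pot_star\<close> is defined by \<open>lim\<close>, which carries information only
  once convergence is known. For all large n the averages lie within \<epsilon>/3 of the single
  number \<integral> h d\<mu>, so they form a Cauchy sequence.\<close>

lemma pot_star_tendsto: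
  assumes f: "AAP T f" and \<mu>: "\<mu> \<in> invariant_measures T"
  shows "(\<lambda>n. (\<integral>x. f n x \<partial>\<mu>) / real n) \<longlonglongrightarrow> pot_star f \<mu>"
proof -
  have "Cauchy (\<lambda>n. (\<integral>x. f n x \<partial>\<mu>) / real n)"
  proof (rule metric_CauchyI)
    fix \<epsilon> :: real assume "\<epsilon> > 0"
    then have "\<epsilon>/3 > 0" by simp
    then obtain h where h: "continuous_on UNIV h"
      and ev: "\<forall>\<^sub>F n in sequentially. \<forall>x. \<bar>f n x - birk T h n x\<bar> \<le> \<epsilon>/3 * real n"
      using AAP_approx[OF f] by blast
    obtain N where N: "\<And>n. n \<ge> N \<Longrightarrow> \<bar>(\<integral>x. f n x \<partial>\<mu>) / real n - (\<integral>x. h x \<partial>\<mu>)\<bar> \<le> \<epsilon>/3"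
      using AAP_integral_close[OF f \<mu> h ev] unfolding eventually_sequentially by blast
    have "dist ((\<integral>x. f m x \<partial>\<mu>) / real m) ((\<integral>x. f n x \<partial>\<mu>) / real n) < \<epsilon>" if "m \<ge> N" "n \<ge> N" for m n
      using N[OF that(1)] N[OF that(2)] \<open>\<epsilon> > 0\<close> unfolding dist_real_def by linarith
    then show "\<exists>M. \<forall>m\<ge>M. \<forall>n\<ge>M. dist ((\<integral>x. f m x \<partial>\<mu>) / real m) ((\<integral>x. f n x \<partial>\<mu>) / real n) < \<epsilon>" by blast
  qed
  then show ?thesis unfolding pot_star_def using Cauchy_convergent convergent_LIMSEQ_iff by blast
qed

lemma pot_star_close:
  assumes f: "AAP T f" and \<mu>: "\<mu> \<in> invariant_measures T" and h: "continuous_on UNIV h"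
    and ev: "\<forall>\<^sub>F n in sequentially. \<forall>x. \<bar>f n x - birk T h n x\<bar> \<le> \<xi> * real n"
  shows "\<bar>pot_star f \<mu> - (\<integral>x. h x \<partial>\<mu>)\<bar> \<le> \<xi>"
proof -
  have "(\<lambda>n. \<bar>(\<integral>x. f n x \<partial>\<mu>) / real n - (\<integral>x. h x \<partial>\<mu>)\<bar>) \<longlonglongrightarrow> \<bar>pot_star f \<mu> - (\<integral>x. h x \<partial>\<mu>)\<bar>"
    by (intro tendsto_intros pot_star_tendsto f \<mu>)
  then show ?thesis using AAP_integral_close[OF f \<mu> h ev] by (rule tendsto_upperbound) simp
qed

text \<open>Keeps the denominators of the ratios away from 0.\<close>

lemma pot_star_ge:
  assumes g: "AAP T g" and \<mu>: "\<mu> \<in> invariant_measures T"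
    and pos: "\<And>n x. n \<ge> 1 \<Longrightarrow> g n x / real n \<ge> \<sigma>"
  shows "pot_star g \<mu> \<ge> \<sigma>"
proof -
  have p: "prob_space \<mu>" "sets \<mu> = sets borel" using \<mu> by (simp_all add: invariant_measures_def)
  interpret prob_space \<mu> by fact
  have "(\<integral>x. g n x \<partial>\<mu>) / real n \<ge> \<sigma>" if "n \<ge> 1" for n
  proof -
    have "integrable \<mu> (g n)" using g that by (auto intro!: integrable_continuous p simp: AAP_def)
    then have "(\<integral>x. \<sigma> \<partial>\<mu>) \<le> (\<integral>x. g n x / real n \<partial>\<mu>)" using pos that by (intro integral_mono) auto
    then show ?thesis by (simp add: prob_space)
  qed
  then show ?thesis
    by (intro tendsto_lowerbound[OF pot_star_tendsto[OF g \<mu>]]) (auto simp: eventually_sequentially)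
qed

text \<open>\<open>H\<close> asks for convergence of Birkhoff averages for just one approximating
  function per precision. This covers both weak* limits, where all continuous functions converge,
  and points controlled on a countable family only. Three errors of \<epsilon>/4 are added.\<close>

lemma AAP_tendsto_pot_star:
  assumes f: "AAP T f" and \<mu>: "\<mu> \<in> invariant_measures T" and r: "filterlim r at_top sequentially"
    and H: "\<And>\<xi>. \<xi> > 0 \<Longrightarrow> \<exists>h. continuous_on UNIV h
        \<and> (\<forall>\<^sub>F n in sequentially. \<forall>x. \<bar>f n x - birk T h n x\<bar> \<le> \<xi> * real n)
        \<and> (\<lambda>k. birk T h (r k) x / real (r k)) \<longlonglongrightarrow> (\<integral>y. h y \<partial>\<mu>)"
  shows "(\<lambda>k. f (r k) x / real (r k)) \<longlonglongrightarrow> pot_star f \<mu>"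
proof (rule tendstoI)
  fix \<epsilon> :: real assume \<epsilon>: "\<epsilon> > 0"
  obtain h where h: "continuous_on UNIV h"
    and ev: "\<forall>\<^sub>F n in sequentially. \<forall>x. \<bar>f n x - birk T h n x\<bar> \<le> \<epsilon>/4 * real n"
    and lim: "(\<lambda>k. birk T h (r k) x / real (r k)) \<longlonglongrightarrow> (\<integral>y. h y \<partial>\<mu>)"
    using H[of "\<epsilon>/4"] \<epsilon> by auto
  have close: "\<bar>pot_star f \<mu> - (\<integral>x. h x \<partial>\<mu>)\<bar> \<le> \<epsilon>/4" by (rule pot_star_close[OF f \<mu> h ev])
  have "\<forall>\<^sub>F k in sequentially. dist (birk T h (r k) x / real (r k)) (\<integral>y. h y \<partial>\<mu>) < \<epsilon>/4"
    using tendstoD[OF lim, of "\<epsilon>/4"] \<epsilon> by simp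
  moreover have "\<forall>\<^sub>F k in sequentially. \<forall>x. \<bar>f (r k) x - birk T h (r k) x\<bar> \<le> \<epsilon>/4 * real (r k)"
    using eventually_compose_filterlim[OF ev r] .
  moreover have "\<forall>\<^sub>F k in sequentially. r k \<ge> 1"
    using r by (simp add: filterlim_at_top)
  ultimately show "\<forall>\<^sub>F k in sequentially. dist (f (r k) x / real (r k)) (pot_star f \<mu>) < \<epsilon>"
  proof eventually_elim
    case (elim k)
    have "\<bar>f (r k) x / real (r k) - birk T h (r k) x / real (r k)\<bar> = \<bar>f (r k) x - birk T h (r k) x\<bar> / real (r k)"
      by (simp add: diff_divide_distrib[symmetric])
    also have "\<dots> \<le> \<epsilon>/4" using elim(2,3) by (simp add: divide_le_eq)
    finally show ?case using elim(1) close \<epsilon> unfolding dist_real_def by linarith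
  qed
qed

end

section \<open>Generic points from specification\<close>

lemma sum_lessThan_add:
  fixes g :: "nat \<Rightarrow> 'b::comm_monoid_add"
  shows "(\<Sum>i<a+b. g i) = (\<Sum>i<a. g i) + (\<Sum>i<b. g (a + i))"
  by (induction b) (simp_all add: add.assoc)

lemma sum_lessThan_mult:
  fixes g :: "nat \<Rightarrow> 'b::comm_monoid_add"
  shows "(\<Sum>i<N*k. g i) = (\<Sum>j<N. \<Sum>i<k. g (j * k + i))"
proof (induction N)
  case (Suc N)
  have "(\<Sum>i<Suc N * k. g i) = (\<Sum>i<N * k + k. g i)" by (simp add: add.commute)
  then show ?case using Suc by (simp add: sum_lessThan_add)
qed simp

text \<open>The complete blocks cost \<open>D\<close> per unit of time. The last, truncated block
  costs at most \<open>C * real P\<close> independently of \<open>r\<close>; this term becomes the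
  constant B of \<open>specification_extension\<close>.\<close>

lemma abs_sum_blocks_le:
  fixes w :: "nat \<Rightarrow> real"
  assumes P: "P > 0" and C: "\<And>i. \<bar>w i\<bar> \<le> C" and "D \<ge> 0"
    and blocks: "\<And>q. q * P < r \<Longrightarrow> \<bar>\<Sum>i<P. w (q * P + i)\<bar> \<le> D * real P"
  shows "\<bar>\<Sum>i<r. w i\<bar> \<le> D * real r + C * real P"
proof -
  define Q where "Q = r div P"
  have r: "r = Q * P + r mod P" unfolding Q_def by simp
  have "\<bar>\<Sum>i<Q*P. w i\<bar> \<le> (\<Sum>q<Q. \<bar>\<Sum>i<P. w (q * P + i)\<bar>)"
    unfolding sum_lessThan_mult by (rule sum_abs)
  also have "\<dots> \<le> (\<Sum>q<Q. D * real P)"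
  proof (rule sum_mono)
    fix q assume "q \<in> {..<Q}"
    then have "q * P < Q * P" using P by simp
    then show "\<bar>\<Sum>i<P. w (q * P + i)\<bar> \<le> D * real P" using r by (intro blocks) linarith
  qed
  also have "\<dots> = D * real (Q * P)" by simp
  also have "\<dots> \<le> D * real r" using r \<open>D \<ge> 0\<close> by (intro mult_left_mono) linarith+
  finally have 1: "\<bar>\<Sum>i<Q*P. w i\<bar> \<le> D * real r" .
  have "\<bar>\<Sum>i<r mod P. w (Q * P + i)\<bar> \<le> (\<Sum>i<r mod P. \<bar>w (Q * P + i)\<bar>)" by (rule sum_abs)
  also have "\<dots> \<le> (\<Sum>i<r mod P. C)" by (intro sum_mono C)
  also have "\<dots> = C * real (r mod P)" by simp
  also have "\<dots> \<le> C * real P"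
    using C[of 0] mod_less_divisor[OF P, of r] by (intro mult_left_mono) linarith+
  finally have 2: "\<bar>\<Sum>i<r mod P. w (Q * P + i)\<bar> \<le> C * real P" .
  have "(\<Sum>i<r. w i) = (\<Sum>i<Q*P. w i) + (\<Sum>i<r mod P. w (Q * P + i))"
    using sum_lessThan_add[of w "Q * P" "r mod P"] r by simp
  then show ?thesis using 1 2 by linarith
qed

text \<open>
  The points are chosen greedily. Since the centred functions w have mean zero, averaging over x the
  sum over h of (s h + w h x)^2 gives at most the sum of (s h)^2 plus a constant D, so some x does no
  worse. After N steps the squared deviations are at most N D, which is o(N^2).
\<close>

lemma (in prob_space) finite_average_approx:
  fixes u :: "'i \<Rightarrow> 'a \<Rightarrow> real"
  assumes H: "finite H" and meas: "\<And>h. h \<in> H \<Longrightarrow> u h \<in> borel_measurable M"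
    and C: "\<And>h x. h \<in> H \<Longrightarrow> \<bar>u h x\<bar> \<le> C" and \<delta>: "\<delta> > 0"
  shows "\<exists>N\<ge>1. \<exists>xs. \<forall>h\<in>H. \<bar>\<Sum>j<N. u h (xs j) - expectation (u h)\<bar> \<le> \<delta> * real N"
proof -
  define w where "w h x = u h x - expectation (u h)" for h x
  define D where "D = real (card H) * (2 * C)^2"
  have iu: "integrable M (u h)" if "h \<in> H" for h
    using meas[OF that] C[OF that] by (intro integrable_const_bound[of _ C]) auto
  have iw: "integrable M (w h)" "expectation (w h) = 0" if "h \<in> H" for h
    unfolding w_def using iu[OF that] by (auto simp: prob_space)
  have wC: "\<bar>w h x\<bar> \<le> 2 * C" if "h \<in> H" for h x
  proof -
    have "\<bar>expectation (u h)\<bar> \<le> expectation (\<lambda>x. \<bar>u h x\<bar>)"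
      using integral_norm_bound[of M "u h"] by simp
    also have "\<dots> \<le> expectation (\<lambda>x. C)" using iu[OF that] C[OF that] by (intro integral_mono) auto
    finally show ?thesis using C[OF that, of x] by (simp add: w_def prob_space)
  qed
  have w2: "(w h x)^2 \<le> (2 * C)^2" if "h \<in> H" for h x
    using power_mono[OF wC[OF that, of x] abs_ge_zero, of 2] by simp
  have iw2: "integrable M (\<lambda>x. (w h x)^2)" if "h \<in> H" for h
    by (rule integrable_const_bound[of _ "(2 * C)^2"])
      (use w2[OF that] meas[OF that] in \<open>auto simp: w_def\<close>)
  have step: "\<exists>x. (\<Sum>h\<in>H. (s h + w h x)^2) \<le> (\<Sum>h\<in>H. (s h)^2) + D" for s :: "'i \<Rightarrow> real"
  proof (rule ccontr)
    assume "\<not> ?thesis"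
    then have less: "(\<Sum>h\<in>H. (s h)^2) + D < (\<Sum>h\<in>H. (s h + w h x)^2)" for x by (simp add: not_le)
    have eq: "(s h + w h x)^2 = (s h)^2 + 2 * s h * w h x + (w h x)^2" for h x
      by (simp add: power2_eq_square algebra_simps)
    have i: "integrable M (\<lambda>x. (s h + w h x)^2)" if "h \<in> H" for h
      unfolding eq using iw(1)[OF that] iw2[OF that] by auto
    have "(\<Sum>h\<in>H. (s h)^2) + D < expectation (\<lambda>x. \<Sum>h\<in>H. (s h + w h x)^2)"
      by (intro expectation_greater Bochner_Integration.integrable_sum i) (auto simp: less)
    also have "\<dots> = (\<Sum>h\<in>H. expectation (\<lambda>x. (s h + w h x)^2))"
      by (intro Bochner_Integration.integral_sum i)
    also have "\<dots> \<le> (\<Sum>h\<in>H. (s h)^2 + (2 * C)^2)"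
    proof (rule sum_mono)
      fix h assume h: "h \<in> H"
      have "expectation (\<lambda>x. (w h x)^2) \<le> expectation (\<lambda>x. (2 * C)^2)"
        using w2[OF h] iw2[OF h] by (intro integral_mono) auto
      then have "expectation (\<lambda>x. (w h x)^2) \<le> (2 * C)^2" by (simp add: prob_space)
      \<comment> \<open>The mixed term \<open>2 * s h * w h x\<close> has expectation 0 because
        \<open>w h\<close> is centred.\<close>
      moreover have "expectation (\<lambda>x. (s h + w h x)^2) = (s h)^2 + expectation (\<lambda>x. (w h x)^2)"
        unfolding eq using iw[OF h] iw2[OF h] by (simp add: prob_space)
      ultimately show "expectation (\<lambda>x. (s h + w h x)^2) \<le> (s h)^2 + (2 * C)^2" by simp
    qed
    also have "\<dots> = (\<Sum>h\<in>H. (s h)^2) + D" by (simp add: sum.distrib D_def)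
    finally show False by simp
  qed
  have ex: "\<exists>xs. (\<Sum>h\<in>H. (\<Sum>j<N. w h (xs j))^2) \<le> real N * D" for N
  proof (induction N)
    case (Suc N)
    then obtain xs where xs: "(\<Sum>h\<in>H. (\<Sum>j<N. w h (xs j))^2) \<le> real N * D" by blast
    obtain x where "(\<Sum>h\<in>H. ((\<Sum>j<N. w h (xs j)) + w h x)^2) \<le> (\<Sum>h\<in>H. (\<Sum>j<N. w h (xs j))^2) + D"
      using step[of "\<lambda>h. \<Sum>j<N. w h (xs j)"] by blast
    then have "(\<Sum>h\<in>H. (\<Sum>j<Suc N. w h ((xs(N := x)) j))^2) \<le> real (Suc N) * D"
      using xs by (simp add: algebra_simps)
    then show ?case by blast
  qed simp
  \<comment> \<open>Chosen so that \<open>real N * D\<close> is at most (\<delta> N)^2; the summand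
    1 keeps \<open>N\<close> positive when \<open>D\<close> is 0.\<close>
  define N where "N = nat \<lceil>D / \<delta>^2\<rceil> + 1"
  have "D / \<delta>^2 \<le> real N" unfolding N_def by linarith
  then have N: "D \<le> real N * \<delta>^2" using \<delta> by (simp add: divide_le_eq)
  obtain xs where xs: "(\<Sum>h\<in>H. (\<Sum>j<N. w h (xs j))^2) \<le> real N * D" using ex by blast
  have "\<bar>\<Sum>j<N. w h (xs j)\<bar> \<le> \<delta> * real N" if "h \<in> H" for h
  proof -
    have "(\<Sum>j<N. w h (xs j))^2 \<le> (\<Sum>h\<in>H. (\<Sum>j<N. w h (xs j))^2)"
      using H that by (intro member_le_sum) auto
    also have "\<dots> \<le> real N * (real N * \<delta>^2)" using xs N by (meson mult_left_mono of_nat_0_le_iff order_trans)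
    also have "\<dots> = (\<delta> * real N)^2" by (simp add: power2_eq_square)
    finally show ?thesis using \<delta> by (simp add: abs_le_square_iff[symmetric] abs_mult)
  qed
  moreover have "N \<ge> 1" by (simp add: N_def)
  ultimately show ?thesis unfolding w_def by blast
qed

section \<open>Gluing orbit segments that represent an invariant measure\<close>

context compact_dynamics
begin

lemma birk_add: "birk T h (L + r) x = birk T h L x + (\<Sum>i<r. h ((T ^^ (L + i)) x))"
  unfolding birk_def by (rule sum_lessThan_add)

lemma abs_birk_le:
  assumes "\<And>x. \<bar>h x\<bar> \<le> C"
  shows "\<bar>birk T h n x\<bar> \<le> C * real n"
proof -
  have "\<bar>birk T h n x\<bar> \<le> (\<Sum>i<n. \<bar>h ((T ^^ i) x)\<bar>)" unfolding birk_def by (rule sum_abs)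
  also have "\<dots> \<le> (\<Sum>i<n. C)" by (intro sum_mono assms)
  finally show ?thesis by (simp add: mult.commute)
qed

lemma abs_integral_le:
  fixes h :: "'a \<Rightarrow> real"
  assumes "prob_space \<mu>" "sets \<mu> = sets borel" "continuous_on UNIV h" "\<And>x. \<bar>h x\<bar> \<le> C"
  shows "\<bar>\<integral>x. h x \<partial>\<mu>\<bar> \<le> C"
proof -
  interpret prob_space \<mu> by fact
  have "\<bar>\<integral>x. h x \<partial>\<mu>\<bar> \<le> (\<integral>x. \<bar>h x\<bar> \<partial>\<mu>)" using integral_norm_bound[of \<mu> h] by simp
  also have "\<dots> \<le> (\<integral>x. C \<partial>\<mu>)"
    using integrable_continuous[OF assms(1-3)] assms(4) by (intro integral_mono) auto
  finally show ?thesis by (simp add: prob_space)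
qed

lemma finite_uniform_bound:
  fixes H :: "('a \<Rightarrow> real) set"
  assumes "finite H" "\<And>h. h \<in> H \<Longrightarrow> continuous_on UNIV h"
  obtains C where "C > 0" "\<And>h x. h \<in> H \<Longrightarrow> \<bar>h x\<bar> \<le> C"
proof -
  have "\<forall>h\<in>H. \<exists>C. \<forall>x. \<bar>h x\<bar> \<le> C" using assms(2) continuous_bounded by metis
  then obtain c where c: "\<And>h x. h \<in> H \<Longrightarrow> \<bar>h x\<bar> \<le> c h" by metis
  have "\<bar>h x\<bar> \<le> 1 + (\<Sum>h\<in>H. \<bar>c h\<bar>)" if "h \<in> H" for h x
    using c[OF that, of x] member_le_sum[OF that, of "\<lambda>h. \<bar>c h\<bar>"] assms(1) by auto
  moreover have "1 + (\<Sum>h\<in>H. \<bar>c h\<bar>) > 0" by (simp add: add_pos_nonneg sum_nonneg)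
  ultimately show thesis using that by blast
qed

lemma uniform_modulus:
  fixes h :: "'a \<Rightarrow> real"
  assumes "continuous_on UNIV h" "\<delta> > 0"
  obtains d where "d > 0" "\<And>x y. dist x y < d \<Longrightarrow> \<bar>h x - h y\<bar> < \<delta>"
  using compact_uniformly_continuous[OF assms(1) compact_space] assms(2)
  unfolding uniformly_continuous_on_def dist_real_def by (metis UNIV_I)

lemma finite_uniform_modulus:
  fixes H :: "('a \<Rightarrow> real) set"
  assumes "finite H" "\<And>h. h \<in> H \<Longrightarrow> continuous_on UNIV h" "\<delta> > 0"
  obtains d where "d > 0" "\<And>h x y. h \<in> H \<Longrightarrow> dist x y < d \<Longrightarrow> \<bar>h x - h y\<bar> < \<delta>"
proof -
  have "\<forall>h\<in>H. \<exists>d>0. \<forall>x y. dist x y < d \<longrightarrow> \<bar>h x - h y\<bar> < \<delta>"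
    using assms(2,3) uniform_modulus by metis
  then obtain d where d: "\<And>h. h \<in> H \<Longrightarrow> d h > 0"
    "\<And>h x y. h \<in> H \<Longrightarrow> dist x y < d h \<Longrightarrow> \<bar>h x - h y\<bar> < \<delta>" by metis
  define d' where "d' = Min (insert 1 (d ` H))"
  have "d' > 0" unfolding d'_def using assms(1) d(1) by (subst Min_gr_iff) auto
  moreover have "d' \<le> d h" if "h \<in> H" for h unfolding d'_def using assms(1) that by (intro Min_le) auto
  ultimately show thesis using that d(2) by (metis order_less_le_trans)
qed

text \<open>
  The error B may depend on the precision but not on z, L, L'; this allows the time windows to be
  chosen long compared with the B of the next stage.
\<close>

lemma specification_extension:
  fixes H :: "('a \<Rightarrow> real) set"
  assumes spec: "has_specification T" and \<mu>: "\<mu> \<in> invariant_measures T"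
    and H: "finite H" "\<And>h. h \<in> H \<Longrightarrow> continuous_on UNIV h" and \<delta>: "\<delta> > 0" and \<epsilon>: "\<epsilon> > 0"
  shows "\<exists>B\<ge>0. \<forall>z L L'. \<exists>z'. (\<forall>p\<le>L. dist ((T ^^ p) z') ((T ^^ p) z) < \<epsilon>) \<and>
    (\<forall>h\<in>H. \<forall>n. L \<le> n \<longrightarrow> n \<le> L' \<longrightarrow>
      \<bar>birk T h n z' - birk T h L z' - (real n - real L) * (\<integral>x. h x \<partial>\<mu>)\<bar> \<le> \<delta> * (real n - real L) + B)"
proof -
  have p: "prob_space \<mu>" "sets \<mu> = sets borel" using \<mu> by (simp_all add: invariant_measures_def)
  interpret prob_space \<mu> by fact
  obtain C where C: "C > 0" "\<And>h x. h \<in> H \<Longrightarrow> \<bar>h x\<bar> \<le> C" using finite_uniform_bound[OF H] by blast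
  obtain d where d: "d > 0" "\<And>h x y. h \<in> H \<Longrightarrow> dist x y < d \<Longrightarrow> \<bar>h x - h y\<bar> < \<delta>/4"
    using finite_uniform_modulus[OF H, of "\<delta>/4"] \<delta> by auto
  \<comment> \<open>One shadowing precision serves both purposes: staying near the orbit of z, and
    changing each function of \<open>H\<close> by less than \<delta>/4.\<close>
  define \<epsilon>' where "\<epsilon>' = min \<epsilon> d"
  have "\<epsilon>' > 0" using \<epsilon> d by (simp add: \<epsilon>'_def)
  then obtain m :: nat where m: "\<And>k a b (xs :: nat \<Rightarrow> 'a). (\<forall>j<k. a j \<le> b j) \<Longrightarrow> (\<forall>j. Suc j < k \<longrightarrow> b j + m \<le> a (Suc j)) \<Longrightarrow>
     \<exists>x. \<forall>j<k. \<forall>p\<le>b j - a j. dist ((T ^^ (p + a j)) x) ((T ^^ p) (xs j)) < \<epsilon>'"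
    using spec unfolding has_specification_def by metis
  \<comment> \<open>The orbit is uncontrolled during a gap of length \<open>m\<close>, where a
    centred sum can reach \<open>2 * C * real m\<close>. Segments of length \<open>n\<close> are
    long enough for this to be at most n \<delta>/4.\<close>
  define n where "n = nat \<lceil>8 * C * real m / \<delta>\<rceil> + 1"
  have "8 * C * real m / \<delta> \<le> real n" unfolding n_def by linarith
  then have mn: "2 * C * real m \<le> real n * \<delta> / 4" using \<delta> by (simp add: divide_le_eq)
  have n1: "n \<ge> 1" by (simp add: n_def)
  have bound: "\<bar>birk T h n x / real n\<bar> \<le> C" if "h \<in> H" for h x
    using abs_birk_le[of h C n x] C(2)[OF that] n1 by (simp add: divide_le_eq)
  have meas: "(\<lambda>x. birk T h n x / real n) \<in> borel_measurable \<mu>" if "h \<in> H" for h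
    by (intro borel_measurable_divide borel_measurable_const borel_measurable_continuous p continuous_birk H that)
  have quarter: "\<delta>/4 > 0" using \<delta> by simp
  \<comment> \<open>By invariance the \<open>n\<close>-th Birkhoff average of h has mean \<integral>
    h d\<mu>. So the \<open>N\<close> segments of length \<open>n\<close> starting at
    \<open>xs j\<close> jointly represent \<mu> on all of \<open>H\<close>.\<close>
  obtain N and xs :: "nat \<Rightarrow> 'a" where N: "N \<ge> 1" and "\<And>h. h \<in> H \<Longrightarrow>
      \<bar>\<Sum>j<N. birk T h n (xs j) / real n - (\<integral>x. birk T h n x / real n \<partial>\<mu>)\<bar> \<le> \<delta>/4 * real N"
    using finite_average_approx[where u = "\<lambda>h x. birk T h n x / real n", OF H(1) meas bound quarter] by blast
  then have xs: "\<bar>\<Sum>j<N. birk T h n (xs j) / real n - (\<integral>x. h x \<partial>\<mu>)\<bar> \<le> \<delta>/4 * real N" if "h \<in> H" for h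
    using that n1 by (simp add: integral_birk[OF \<mu> H(2)])
  \<comment> \<open>\<open>k\<close> is the length of one gap followed by one segment, and
    \<open>P\<close> that of a full round through the \<open>N\<close> segments.\<close>
  define k where "k = n + m"
  define P where "P = N * k"
  have P: "P > 0" using N n1 by (simp add: P_def k_def)
  have "\<exists>z'. (\<forall>p\<le>L. dist ((T ^^ p) z') ((T ^^ p) z) < \<epsilon>) \<and>
    (\<forall>h\<in>H. \<forall>l. L \<le> l \<longrightarrow> l \<le> L' \<longrightarrow>
      \<bar>birk T h l z' - birk T h L z' - (real l - real L) * (\<integral>x. h x \<partial>\<mu>)\<bar>
        \<le> \<delta> * (real l - real L) + 2 * C * real P)" for z L L'
  proof -
    \<comment> \<open>Interval 0 follows \<open>z\<close> up to time \<open>L\<close> inclusive.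
      Interval \<open>Suc j\<close> begins after the j-th slot's gap of length \<open>m\<close> and
      follows \<open>xs (j mod N)\<close>; its \<open>n\<close> times include both ends, hence
      \<open>n - 1\<close>. Having \<open>N * L'\<close> such intervals suffices: a round that
      starts before time L' has number below L', as \<open>P\<close> is positive.\<close>
    define a where "a j = (case j of 0 \<Rightarrow> 0 | Suc j \<Rightarrow> L + m + j * k)" for j
    define b where "b j = (case j of 0 \<Rightarrow> L | Suc j \<Rightarrow> L + m + j * k + (n - 1))" for j
    define y where "y j = (case j of 0 \<Rightarrow> z | Suc j \<Rightarrow> xs (j mod N))" for j
    have "\<forall>j<Suc (N * L'). a j \<le> b j" by (auto simp: a_def b_def split: nat.split)
    moreover have "\<forall>j. Suc j < Suc (N * L') \<longrightarrow> b j + m \<le> a (Suc j)"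
      using n1 by (auto simp: a_def b_def k_def split: nat.split)
    ultimately obtain z' where z': "\<And>j p. j < Suc (N * L') \<Longrightarrow> p \<le> b j - a j \<Longrightarrow>
        dist ((T ^^ (p + a j)) z') ((T ^^ p) (y j)) < \<epsilon>'"
      using m[of "Suc (N * L')" a b y] by metis
    have start: "dist ((T ^^ p) z') ((T ^^ p) z) < \<epsilon>" if "p \<le> L" for p
      using z'[of 0 p] that by (simp add: a_def b_def y_def \<epsilon>'_def)
    have shadow: "dist ((T ^^ (L + (j * k + (m + p)))) z') ((T ^^ p) (xs (j mod N))) < d" if "j < N * L'" "p < n" for j p
      using z'[of "Suc j" p] that by (simp add: a_def b_def y_def \<epsilon>'_def add_ac)
    have "\<bar>birk T h l z' - birk T h L z' - (real l - real L) * (\<integral>x. h x \<partial>\<mu>)\<bar>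
        \<le> \<delta> * (real l - real L) + 2 * C * real P" if h: "h \<in> H" and l: "L \<le> l" "l \<le> L'" for h l
    proof -
      define c where "c = (\<integral>x. h x \<partial>\<mu>)"
      define w where "w i = h ((T ^^ (L + i)) z') - c" for i
      have "\<bar>c\<bar> \<le> C" unfolding c_def by (rule abs_integral_le[OF p H(2)[OF h] C(2)[OF h]])
      then have wC: "\<bar>w i\<bar> \<le> 2 * C" for i using C(2)[OF h, of "(T ^^ (L + i)) z'"] by (simp add: w_def)
      \<comment> \<open>One slot: the gap costs at most n \<delta>/4 by the choice of
        \<open>n\<close>, and replacing the glued orbit by that of \<open>xs (j mod N)\<close> costs
        as much again.\<close>
      have W: "\<bar>(\<Sum>i<k. w (j * k + i)) - real n * (birk T h n (xs (j mod N)) / real n - c)\<bar> \<le> real n * \<delta> / 2"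
        if j: "j < N * L'" for j
      proof -
        have "(\<Sum>i<k. w (j * k + i)) = (\<Sum>i<m. w (j * k + i)) + (\<Sum>p<n. w (j * k + (m + p)))"
          using sum_lessThan_add[of "\<lambda>i. w (j * k + i)" m n] by (simp add: k_def add_ac)
        moreover have "\<bar>\<Sum>i<m. w (j * k + i)\<bar> \<le> real n * \<delta> / 4"
        proof -
          have "\<bar>\<Sum>i<m. w (j * k + i)\<bar> \<le> (\<Sum>i<m. \<bar>w (j * k + i)\<bar>)" by (rule sum_abs)
          also have "\<dots> \<le> (\<Sum>i<m. 2 * C)" by (intro sum_mono wC)
          finally show ?thesis using mn by (simp add: mult_ac)
        qed
        moreover have "\<bar>(\<Sum>p<n. w (j * k + (m + p))) - real n * (birk T h n (xs (j mod N)) / real n - c)\<bar> \<le> real n * \<delta> / 4"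
        proof -
          have "(\<Sum>p<n. w (j * k + (m + p))) - real n * (birk T h n (xs (j mod N)) / real n - c)
              = (\<Sum>p<n. h ((T ^^ (L + (j * k + (m + p)))) z') - h ((T ^^ p) (xs (j mod N))))"
            using n1 by (simp add: w_def birk_def sum_subtractf right_diff_distrib)
          also have "\<bar>\<dots>\<bar> \<le> (\<Sum>p<n. \<bar>h ((T ^^ (L + (j * k + (m + p)))) z') - h ((T ^^ p) (xs (j mod N)))\<bar>)"
            by (rule sum_abs)
          also have "\<dots> \<le> (\<Sum>p<n. \<delta>/4)"
            by (intro sum_mono less_imp_le d(2) h shadow j) auto
          finally show ?thesis by simp
        qed
        moreover have "\<bar>a - d\<bar> \<le> X / 2" if "a = b + c" "\<bar>b\<bar> \<le> X / 4" "\<bar>c - d\<bar> \<le> X / 4" for a b c d X :: real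
          using that by linarith
        ultimately show ?thesis by blast
      qed
      have block: "\<bar>\<Sum>i<P. w (q * P + i)\<bar> \<le> \<delta> * real P" if q: "q * P < l - L" for q
      proof -
        have "q < L'"
        proof -
          have "q * 1 \<le> q * P" using P by (intro mult_le_mono2) simp
          then show ?thesis using q l by linarith
        qed
        then have "Suc q * N \<le> L' * N" by (intro mult_le_mono1) simp
        then have qN: "q * N + j < N * L'" if "j < N" for j using that by (simp add: mult.commute)
        define V where "V j = (\<Sum>i<k. w ((q * N + j) * k + i))" for j
        define u where "u j = birk T h n (xs j) / real n - c" for j
        have "(\<Sum>i<P. w (q * P + i)) = (\<Sum>j<N. V j)"
          unfolding P_def sum_lessThan_mult V_def by (simp add: algebra_simps)
        also have "\<dots> = (\<Sum>j<N. V j - real n * u j) + real n * (\<Sum>j<N. u j)"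
          by (simp add: sum_subtractf sum_distrib_left)
        finally have "\<bar>\<Sum>i<P. w (q * P + i)\<bar> \<le> \<bar>\<Sum>j<N. V j - real n * u j\<bar> + real n * \<bar>\<Sum>j<N. u j\<bar>"
          using abs_triangle_ineq[of "\<Sum>j<N. V j - real n * u j" "real n * (\<Sum>j<N. u j)"] by (simp add: abs_mult)
        also have "\<bar>\<Sum>j<N. V j - real n * u j\<bar> \<le> (\<Sum>j<N. \<bar>V j - real n * u j\<bar>)" by (rule sum_abs)
        also have "\<dots> \<le> (\<Sum>j<N. real n * \<delta> / 2)"
        proof (rule sum_mono)
          fix j assume "j \<in> {..<N}"
          then show "\<bar>V j - real n * u j\<bar> \<le> real n * \<delta> / 2"
            using W[OF qN[of j]] by (simp add: V_def u_def)
        qed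
        also have "\<bar>\<Sum>j<N. u j\<bar> \<le> \<delta>/4 * real N" using xs[OF h] by (simp add: u_def c_def)
        finally have "\<bar>\<Sum>i<P. w (q * P + i)\<bar> \<le> (\<Sum>j<N. real n * \<delta> / 2) + real n * (\<delta>/4 * real N)"
          by (simp add: mult_left_mono)
        \<comment> \<open>Gaps, shadowing and the deviation of the mean over \<open>xs\<close>
          contribute one quarter each.\<close>
        also have "\<dots> = 3/4 * (\<delta> * (real N * real n))" by simp
        also have "\<dots> \<le> 1 * (\<delta> * (real N * real k))"
          using \<delta> by (intro mult_mono) (auto simp: k_def)
        finally show ?thesis by (simp add: P_def)
      qed
      have "\<bar>\<Sum>i<l - L. w i\<bar> \<le> \<delta> * real (l - L) + 2 * C * real P"
        by (rule abs_sum_blocks_le[OF P wC _ block]) (use \<delta> in auto)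
      moreover have "birk T h l z' - birk T h L z' = (\<Sum>i<l - L. h ((T ^^ (L + i)) z'))"
        using birk_add[of h L "l - L" z'] l by simp
      ultimately show ?thesis using l by (simp add: w_def sum_subtractf c_def of_nat_diff)
    qed
    then show ?thesis using start by blast
  qed
  then show ?thesis using C(1) by (intro exI[of _ "2 * C * real P"]) auto
qed


text \<open>Stage \<open>k\<close> prolongs the orbit of \<open>z k\<close> from time
  \<open>L k\<close> to \<open>L (Suc k)\<close>, with error rate 1/(k+1) for the functions
  \<open>hh 0\<close>, ..., \<open>hh k\<close> and shadowing error below 2^(-k). These errors are
  summable, so a limit point \<open>x\<close> follows every \<open>z k\<close> up to time
  \<open>L k\<close>. The constants \<open>B k\<close> come before the choice of times, which is
  what allows \<open>L\<close> to be built from them.\<close>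

lemma specification_generic_point:
  fixes hh :: "nat \<Rightarrow> 'a \<Rightarrow> real"
  assumes spec: "has_specification T" and \<mu>: "\<mu> \<in> invariant_measures T"
    and hh: "\<And>j. continuous_on UNIV (hh j)"
  obtains x where "\<And>j. (\<lambda>n. birk T (hh j) n x / real n) \<longlonglongrightarrow> (\<integral>y. hh j y \<partial>\<mu>)"
proof -
  have p: "prob_space \<mu>" "sets \<mu> = sets borel" using \<mu> by (simp_all add: invariant_measures_def)
  have "\<forall>k. \<exists>B\<ge>0. \<forall>z L L'. \<exists>z'. (\<forall>p\<le>L. dist ((T ^^ p) z') ((T ^^ p) z) < (1/2)^k) \<and>
    (\<forall>h\<in>hh ` {..k}. \<forall>n. L \<le> n \<longrightarrow> n \<le> L' \<longrightarrow>
      \<bar>birk T h n z' - birk T h L z' - (real n - real L) * (\<integral>x. h x \<partial>\<mu>)\<bar> \<le> 1 / real (Suc k) * (real n - real L) + B)"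
    by (intro allI specification_extension[OF spec \<mu>]) (auto simp: hh)
  then obtain B where B: "\<And>k. B k \<ge> (0::real)" and
    "\<forall>k z L L'. \<exists>z'. (\<forall>p\<le>L. dist ((T ^^ p) z') ((T ^^ p) z) < (1/2)^k) \<and>
    (\<forall>h\<in>hh ` {..k}. \<forall>n. L \<le> n \<longrightarrow> n \<le> L' \<longrightarrow>
      \<bar>birk T h n z' - birk T h L z' - (real n - real L) * (\<integral>x. h x \<partial>\<mu>)\<bar> \<le> 1 / real (Suc k) * (real n - real L) + B k)"
    by (metis (no_types))
  then obtain Z where Z: "\<And>k z L L' p. p \<le> L \<Longrightarrow> dist ((T ^^ p) (Z k z L L')) ((T ^^ p) z) < (1/2)^k"
    "\<And>k z L L' h n. h \<in> hh ` {..k} \<Longrightarrow> L \<le> n \<Longrightarrow> n \<le> L' \<Longrightarrow>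
      \<bar>birk T h n (Z k z L L') - birk T h L (Z k z L L') - (real n - real L) * (\<integral>x. h x \<partial>\<mu>)\<bar>
        \<le> 1 / real (Suc k) * (real n - real L) + B k"
    by (metis (no_types))
  \<comment> \<open>The growth makes B k negligible at time L k, and the orbit up to L k negligible at time L (Suc k).\<close>
  define L where "L = rec_nat (nat \<lceil>B 0\<rceil> + 1) (\<lambda>k l. (k + 2) * (l + nat \<lceil>B (Suc k)\<rceil> + 1))"
  define z where "z = rec_nat undefined (\<lambda>k y. Z k y (L k) (L (Suc k)))"
  have LS: "L (Suc k) = (k + 2) * (L k + nat \<lceil>B (Suc k)\<rceil> + 1)" for k by (simp add: L_def)
  have zS: "z (Suc k) = Z k (z k) (L k) (L (Suc k))" for k by (simp add: z_def)
  have LS_ge: "(k + 2) * L k \<le> L (Suc k)" for k unfolding LS by (intro mult_le_mono2) simp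
  have "L k < L (Suc k)" for k unfolding LS by simp
  then have smL: "strict_mono L" by (simp add: strict_mono_Suc_iff)
  have LB: "real (Suc k) * B k \<le> real (L k)" for k
  proof (cases k)
    case 0
    have "B 0 \<le> real (nat \<lceil>B 0\<rceil> + 1)" by linarith
    then show ?thesis using 0 by (simp add: L_def)
  next
    case (Suc i)
    have "B k \<le> real (L i + nat \<lceil>B k\<rceil> + 1)" by linarith
    then have "real (Suc k) * B k \<le> real (Suc k) * real (L i + nat \<lceil>B k\<rceil> + 1)" by (intro mult_left_mono) auto
    also have "\<dots> = real (L k)" using Suc by (simp only: LS of_nat_mult[symmetric]) simp
    finally show ?thesis .
  qed
  \<comment> \<open>The bound is the partial geometric sum of (1/2)^(k+j) over j < i, in the closed
    form for which the induction goes through.\<close>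
  have near: "dist ((T ^^ p) (z (k + i))) ((T ^^ p) (z k)) \<le> 2 * (1/2)^k - 2 * (1/2)^(k+i)" if "p \<le> L k" for p k i
  proof (induction i)
    case (Suc i)
    have "L k \<le> L (k + i)" using smL by (simp add: strict_mono_less_eq)
    then have "p \<le> L (k + i)" using that by simp
    then have "dist ((T ^^ p) (z (Suc (k + i)))) ((T ^^ p) (z (k + i))) < (1/2)^(k+i)"
      unfolding zS by (rule Z(1))
    then have "dist ((T ^^ p) (z (Suc (k + i)))) ((T ^^ p) (z k)) \<le> (1/2)^(k+i) + (2 * (1/2)^k - 2 * (1/2)^(k+i))"
      using Suc dist_triangle[of "(T ^^ p) (z (Suc (k + i)))" "(T ^^ p) (z k)" "(T ^^ p) (z (k + i))"] by linarith
    then show ?case by simp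
  qed simp
  obtain x s where s: "strict_mono (s :: nat \<Rightarrow> nat)" and x: "(z \<circ> s) \<longlonglongrightarrow> x"
    using compact_space unfolding compact_def by blast
  have shadow: "dist ((T ^^ p) x) ((T ^^ p) (z k)) \<le> 2 * (1/2)^k" if "p \<le> L k" for p k
  proof -
    have "isCont (T ^^ p) x" using continuous_iterate by (simp add: continuous_on_eq_continuous_at)
    then have "(\<lambda>i. (T ^^ p) ((z \<circ> s) i)) \<longlonglongrightarrow> (T ^^ p) x" using x by (rule isCont_tendsto_compose)
    then have "(\<lambda>i. dist ((T ^^ p) ((z \<circ> s) i)) ((T ^^ p) (z k))) \<longlonglongrightarrow> dist ((T ^^ p) x) ((T ^^ p) (z k))"
      by (intro tendsto_intros)
    moreover have "dist ((T ^^ p) ((z \<circ> s) i)) ((T ^^ p) (z k)) \<le> 2 * (1/2)^k" if "i \<ge> k" for i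
    proof -
      have "k \<le> s i" using seq_suble[OF s, of i] that by simp
      then obtain l where l: "s i = k + l" using le_Suc_ex by blast
      have "0 \<le> (1/2::real)^(k+l)" by simp
      then show ?thesis using near[OF \<open>p \<le> L k\<close>, of l] l by (simp only: comp_def)
    qed
    then have "\<forall>\<^sub>F i in sequentially. dist ((T ^^ p) ((z \<circ> s) i)) ((T ^^ p) (z k)) \<le> 2 * (1/2)^k"
      unfolding eventually_sequentially by blast
    ultimately show ?thesis by (rule tendsto_upperbound) simp
  qed
  have "(\<lambda>n. birk T (hh j) n x / real n) \<longlonglongrightarrow> (\<integral>y. hh j y \<partial>\<mu>)" for j
  proof -
    define h where "h = hh j"
    define c where "c = (\<integral>y. h y \<partial>\<mu>)"
    define D where "D n = birk T h n x - real n * c" for n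
    have ch: "continuous_on UNIV h" using hh by (simp add: h_def)
    obtain C where C: "C > 0" "\<And>x. \<bar>h x\<bar> \<le> C" using continuous_bounded[OF ch] by blast
    have "\<bar>c\<bar> \<le> C" unfolding c_def by (rule abs_integral_le[OF p ch C(2)])
    then have nc: "\<bar>real n * c\<bar> \<le> C * real n" for n
      using mult_right_mono[of "\<bar>c\<bar>" C "real n"] by (simp add: abs_mult mult.commute)
    have DC: "\<bar>D n\<bar> \<le> 2 * C * real n" for n
      unfolding D_def using nc[of n] abs_birk_le[of h C n x, OF C(2)] abs_triangle_ineq4[of "birk T h n x" "real n * c"]
      by linarith
    \<comment> \<open>Within one window only the increment of \<open>D\<close> is controlled, but
      relative to the total time \<open>n\<close>.\<close>
    have drift: "\<exists>k0. \<forall>k\<ge>k0. \<forall>n. L k \<le> n \<longrightarrow> n \<le> L (Suc k) \<longrightarrow> \<bar>D n - D (L k)\<bar> \<le> \<eta> * real n" if \<eta>: "\<eta> > 0" for \<eta>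
    proof -
      obtain d where d: "d > 0" "\<And>x y. dist x y < d \<Longrightarrow> \<bar>h x - h y\<bar> < \<eta>/2"
        using uniform_modulus[OF ch, of "\<eta>/2"] \<eta> by auto
      obtain k1 where k1: "(1/2::real)^k1 < d" using real_arch_pow_inv[OF d(1), of "1/2"] by auto
      obtain k2 where k2: "1 / real (Suc k2) < \<eta>/2" using nat_approx_posE[of "\<eta>/2"] \<eta> by (metis half_gt_zero)
      \<comment> \<open>The summand \<open>j\<close> brings \<open>h\<close> into stage
        \<open>k\<close>, \<open>k1\<close> makes the shadowing finer than the modulus
        \<open>d\<close>, and \<open>k2\<close> makes the error rate smaller than \<eta>/2.\<close>
      have "\<bar>D n - D (L k)\<bar> \<le> \<eta> * real n" if k: "k \<ge> j + k1 + k2" and n: "L k \<le> n" "n \<le> L (Suc k)" for k n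
      proof -
        \<comment> \<open>Up to time \<open>L (Suc k)\<close> the orbit of \<open>x\<close> stays
          within 2 (1/2)^(k+1) = (1/2)^k of that of \<open>y\<close>.\<close>
        define y where "y = z (Suc k)"
        have "(1/2::real)^k \<le> (1/2)^k1" using k by (intro power_decreasing) auto
        then have kd: "(1/2::real)^k < d" using k1 by linarith
        have "1 / real (Suc k) \<le> 1 / real (Suc k2)" using k by (intro divide_left_mono) auto
        then have k\<eta>: "1 / real (Suc k) \<le> \<eta>/2" using k2 by simp
        have "h \<in> hh ` {..k}" using k by (auto simp: h_def)
        then have "\<bar>birk T h n y - birk T h (L k) y - (real n - real (L k)) * c\<bar>
            \<le> 1 / real (Suc k) * (real n - real (L k)) + B k"
          unfolding y_def zS c_def using n by (intro Z(2)) auto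
        \<comment> \<open>Rewritten as the error of the missing initial stretch \<open>L k\<close>,
          this term completes the rate on \<open>n - L k\<close> to exactly n/(k+1).\<close>
        also have "B k \<le> 1 / real (Suc k) * real (L k)" using LB[of k] by (simp add: field_simps)
        finally have "\<bar>birk T h n y - birk T h (L k) y - (real n - real (L k)) * c\<bar> \<le> 1 / real (Suc k) * real n"
          by (simp only: distrib_left[symmetric] diff_add_cancel)
        also have "\<dots> \<le> \<eta>/2 * real n" using k\<eta> by (intro mult_right_mono) auto
        finally have 1: "\<bar>birk T h n y - birk T h (L k) y - (real n - real (L k)) * c\<bar> \<le> \<eta>/2 * real n" .
        define r where "r = n - L k"
        have r: "n = L k + r" using n by (simp add: r_def)
        have "\<bar>(\<Sum>i<r. h ((T ^^ (L k + i)) x)) - (\<Sum>i<r. h ((T ^^ (L k + i)) y))\<bar>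
            = \<bar>\<Sum>i<r. h ((T ^^ (L k + i)) x) - h ((T ^^ (L k + i)) y)\<bar>" by (simp add: sum_subtractf)
        also have "\<dots> \<le> (\<Sum>i<r. \<bar>h ((T ^^ (L k + i)) x) - h ((T ^^ (L k + i)) y)\<bar>)" by (rule sum_abs)
        also have "\<dots> \<le> (\<Sum>i<r. \<eta>/2)"
        proof (rule sum_mono)
          fix i assume "i \<in> {..<r}"
          then have "L k + i \<le> L (Suc k)" using n r by simp
          from shadow[OF this] have "dist ((T ^^ (L k + i)) x) ((T ^^ (L k + i)) y) < d" using kd by (simp add: y_def)
          then show "\<bar>h ((T ^^ (L k + i)) x) - h ((T ^^ (L k + i)) y)\<bar> \<le> \<eta>/2" using d(2) less_imp_le by blast
        qed
        also have "\<dots> \<le> \<eta>/2 * real n" using r \<eta> by simp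
        finally have 2: "\<bar>(\<Sum>i<r. h ((T ^^ (L k + i)) x)) - (\<Sum>i<r. h ((T ^^ (L k + i)) y))\<bar> \<le> \<eta>/2 * real n" .
        have "D n - D (L k) = (birk T h n y - birk T h (L k) y - (real n - real (L k)) * c)
            + ((\<Sum>i<r. h ((T ^^ (L k + i)) x)) - (\<Sum>i<r. h ((T ^^ (L k + i)) y)))"
          unfolding D_def r birk_add by (simp add: algebra_simps)
        then show ?thesis using 1 2 by linarith
      qed
      then show ?thesis by blast
    qed
    have small: "\<exists>n0. \<forall>n\<ge>n0. \<bar>D n\<bar> \<le> 3 * \<eta> * real n" if \<eta>: "\<eta> > 0" for \<eta>
    proof -
      obtain k0 where k0: "\<And>k n. k \<ge> k0 \<Longrightarrow> L k \<le> n \<Longrightarrow> n \<le> L (Suc k) \<Longrightarrow> \<bar>D n - D (L k)\<bar> \<le> \<eta> * real n"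
        using drift[OF \<eta>] by blast
      \<comment> \<open>Errors do not accumulate over the stages: for these k the crude bound
        \<open>2 * C * real (L k)\<close> on \<open>D (L k)\<close> is already at most \<eta> times
        \<open>L (Suc k)\<close>, because \<open>L (Suc k)\<close> is at least (k+2) times
        \<open>L k\<close>. A single \<open>drift\<close> then gives
        \<open>endpoint\<close>.\<close>
      define k1 where "k1 = k0 + nat \<lceil>2 * C / \<eta>\<rceil>"
      have endpoint: "\<bar>D (L (Suc k))\<bar> \<le> 2 * \<eta> * real (L (Suc k))" if k: "k \<ge> k1" for k
      proof -
        have "2 * C / \<eta> \<le> real (k + 2)" using k unfolding k1_def by linarith
        then have "2 * C \<le> \<eta> * real (k + 2)" using \<eta> by (simp add: divide_le_eq mult.commute)
        have grow: "real (k + 2) * real (L k) \<le> real (L (Suc k))"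
          using of_nat_mono[OF LS_ge[of k], where 'a = real] by (simp only: of_nat_mult)
        have "2 * C * real (L k) \<le> \<eta> * real (k + 2) * real (L k)"
          using \<open>2 * C \<le> \<eta> * real (k + 2)\<close> by (rule mult_right_mono) simp
        also have "\<dots> \<le> \<eta> * real (L (Suc k))"
          unfolding mult.assoc by (rule mult_left_mono[OF grow]) (use \<eta> in simp)
        finally have "\<bar>D (L k)\<bar> \<le> \<eta> * real (L (Suc k))" using DC[of "L k"] by linarith
        moreover have "\<bar>D (L (Suc k)) - D (L k)\<bar> \<le> \<eta> * real (L (Suc k))"
          using k smL by (intro k0) (auto simp: k1_def strict_mono_less_eq)
        ultimately show ?thesis by linarith
      qed
      have "\<bar>D n\<bar> \<le> 3 * \<eta> * real n" if n: "n \<ge> L (Suc k1)" for n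
      proof -
        \<comment> \<open>Writing this least index as k + 2 puts \<open>n\<close> between
          \<open>L (Suc k)\<close> and \<open>L (Suc (Suc k))\<close>. Then \<open>endpoint\<close>
          controls the left end, with 2 \<eta>, and \<open>drift\<close> adds one more
          \<eta>.\<close>
        define i where "i = (LEAST i. n < L i)"
        have "n < L (Suc n)" using seq_suble[OF smL, of "Suc n"] by simp
        then have i: "n < L i" unfolding i_def by (rule LeastI)
        then have "L (Suc k1) < L i" using n by simp
        then have "Suc k1 < i" using smL by (simp add: strict_mono_less)
        then obtain k where k: "i = Suc (Suc k)" "k \<ge> k1" by (metis Suc_less_eq2 less_imp_Suc_add less_Suc_eq_le)
        have "\<not> n < L (Suc k)" unfolding i_def using not_less_Least[of "Suc k" "\<lambda>i. n < L i"] k(1) i_def by auto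
        then have Lk: "L (Suc k) \<le> n" "n \<le> L (Suc (Suc k))" using i k by auto
        have "\<bar>D n - D (L (Suc k))\<bar> \<le> \<eta> * real n" using Lk k by (intro k0) (auto simp: k1_def)
        moreover have "2 * \<eta> * real (L (Suc k)) \<le> 2 * \<eta> * real n" using Lk \<eta> by (intro mult_left_mono) auto
        ultimately show ?thesis using endpoint[OF k(2)] by linarith
      qed
      then show ?thesis by blast
    qed
    have "(\<lambda>n. birk T h n x / real n) \<longlonglongrightarrow> c"
    proof (rule LIMSEQ_I)
      fix \<epsilon> :: real assume \<epsilon>: "\<epsilon> > 0"
      obtain n0 where n0: "\<And>n. n \<ge> n0 \<Longrightarrow> \<bar>D n\<bar> \<le> 3 * (\<epsilon>/6) * real n" using small[of "\<epsilon>/6"] \<epsilon> by auto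
      have "norm (birk T h n x / real n - c) < \<epsilon>" if "n \<ge> max n0 1" for n
      proof -
        have "birk T h n x / real n - c = D n / real n" using that by (simp add: D_def field_simps)
        also have "norm \<dots> \<le> \<epsilon>/2" using n0[of n] that by (simp add: divide_le_eq)
        finally show ?thesis using \<epsilon> by simp
      qed
      then show "\<exists>no. \<forall>n\<ge>no. norm (birk T h n x / real n - c) < \<epsilon>" by blast
    qed
    then show ?thesis by (simp add: h_def c_def)
  qed
  then show thesis using that by blast
qed

end

section \<open>Comparison of the three suprema\<close>

lemma ratio_tendsto_along:
  fixes u v :: "nat \<Rightarrow> real"
  assumes u: "(\<lambda>k. u (r k) / real (r k)) \<longlonglongrightarrow> a" and v: "(\<lambda>k. v (r k) / real (r k)) \<longlonglongrightarrow> b"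
    and r: "filterlim r at_top sequentially" and b: "b \<noteq> 0"
  shows "(\<lambda>k. u (r k) / v (r k)) \<longlonglongrightarrow> a / b"
proof -
  have "(\<lambda>k. (u (r k) / real (r k)) / (v (r k) / real (r k))) \<longlonglongrightarrow> a / b"
    using u v b by (rule tendsto_divide)
  moreover have "\<forall>\<^sub>F k in sequentially. r k \<ge> 1" using r by (simp add: filterlim_at_top)
  then have "\<forall>\<^sub>F k in sequentially. (u (r k) / real (r k)) / (v (r k) / real (r k)) = u (r k) / v (r k)"
    by eventually_elim simp
  ultimately show ?thesis by (rule Lim_transform_eventually)
qed

section \<open>Potentials along subsequences and along generic orbits\<close>

context compact_dynamics
begin

text \<open>The times are extracted from a prescribed \<open>r\<close>, so that a limsup already
  realised along \<open>r\<close> is preserved.\<close>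

lemma empirical_limit_subsequence:
  fixes r :: "nat \<Rightarrow> nat"
  assumes "strict_mono r"
  obtains s \<mu> where "strict_mono (s :: nat \<Rightarrow> nat)" "\<mu> \<in> empirical_limits T x"
    "\<And>h. continuous_on UNIV h \<Longrightarrow> (\<lambda>k. birk T h ((r \<circ> s) k) x / real ((r \<circ> s) k)) \<longlonglongrightarrow> (\<integral>y. h y \<partial>\<mu>)"
proof (rule weak_star_subsequence[OF compact_space assms, of "\<lambda>i. (T ^^ i) x"])
  fix s :: "nat \<Rightarrow> nat" and \<mu> :: "'a measure"
  assume s: "strict_mono s" and \<mu>: "prob_space \<mu>" "sets \<mu> = sets borel"
    and lim: "\<And>h. continuous_on UNIV h \<Longrightarrow> (\<lambda>k. (\<Sum>i<r (s k). h ((T ^^ i) x)) / real (r (s k))) \<longlonglongrightarrow> (\<integral>y. h y \<partial>\<mu>)"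
  have lim': "(\<lambda>k. birk T h ((r \<circ> s) k) x / real ((r \<circ> s) k)) \<longlonglongrightarrow> (\<integral>y. h y \<partial>\<mu>)" if "continuous_on UNIV h" for h
    using lim[OF that] by (simp add: birk_def)
  have "strict_mono (r \<circ> s)" using assms s by (simp add: strict_mono_o)
  then have "\<mu> \<in> empirical_limits T x" using \<mu> lim' unfolding empirical_limits_def by blast
  then show thesis using that s lim' by blast
qed

lemma AAP_tendsto_along:
  assumes f: "AAP T f" and \<mu>: "\<mu> \<in> invariant_measures T" and r: "filterlim r at_top sequentially"
    and lim: "\<And>h. continuous_on UNIV h \<Longrightarrow> (\<lambda>k. birk T h (r k) x / real (r k)) \<longlonglongrightarrow> (\<integral>y. h y \<partial>\<mu>)"
  shows "(\<lambda>k. f (r k) x / real (r k)) \<longlonglongrightarrow> pot_star f \<mu>"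
proof (rule AAP_tendsto_pot_star[OF f \<mu> r])
  fix \<xi> :: real assume "\<xi> > 0"
  then obtain h where "continuous_on UNIV h" "\<forall>\<^sub>F n in sequentially. \<forall>x. \<bar>f n x - birk T h n x\<bar> \<le> \<xi> * real n"
    using AAP_approx[OF f] by blast
  then show "\<exists>h. continuous_on UNIV h \<and> (\<forall>\<^sub>F n in sequentially. \<forall>x. \<bar>f n x - birk T h n x\<bar> \<le> \<xi> * real n)
      \<and> (\<lambda>k. birk T h (r k) x / real (r k)) \<longlonglongrightarrow> (\<integral>y. h y \<partial>\<mu>)"
    using lim by blast
qed

text \<open>Precisions 1/(j+1) suffice, so a potential is governed by countably many continuous
  functions, as many as a generic point can handle by
  \<open>specification_generic_point\<close>.\<close>

lemma AAP_countable_approx: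
  assumes f: "AAP T f"
  obtains h :: "nat \<Rightarrow> 'a \<Rightarrow> real" where "\<And>j. continuous_on UNIV (h j)"
    "\<And>\<xi>. \<xi> > 0 \<Longrightarrow> \<exists>j. \<forall>\<^sub>F n in sequentially. \<forall>x. \<bar>f n x - birk T (h j) n x\<bar> \<le> \<xi> * real n"
proof -
  have "\<forall>j. \<exists>h. continuous_on UNIV h \<and> (\<forall>\<^sub>F n in sequentially. \<forall>x. \<bar>f n x - birk T h n x\<bar> \<le> 1 / real (Suc j) * real n)"
  proof
    fix j :: nat
    have "1 / real (Suc j) > 0" by simp
    from AAP_approx[OF f this] show "\<exists>h. continuous_on UNIV h \<and>
        (\<forall>\<^sub>F n in sequentially. \<forall>x. \<bar>f n x - birk T h n x\<bar> \<le> 1 / real (Suc j) * real n)" by blast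
  qed
  from choice[OF this] obtain h where h: "\<And>j. continuous_on UNIV (h j)"
    "\<And>j. \<forall>\<^sub>F n in sequentially. \<forall>x. \<bar>f n x - birk T (h j) n x\<bar> \<le> 1 / real (Suc j) * real n" by blast
  have "\<exists>j. \<forall>\<^sub>F n in sequentially. \<forall>x. \<bar>f n x - birk T (h j) n x\<bar> \<le> \<xi> * real n" if "\<xi> > 0" for \<xi>
  proof -
    obtain j where j: "1 / real (Suc j) < \<xi>" using nat_approx_posE[OF \<open>\<xi> > 0\<close>] .
    have "\<forall>\<^sub>F n in sequentially. \<forall>x. \<bar>f n x - birk T (h j) n x\<bar> \<le> \<xi> * real n"
      using h(2)[of j]
    proof eventually_elim
      case (elim n)
      have "1 / real (Suc j) * real n \<le> \<xi> * real n" using j by (intro mult_right_mono) auto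
      then show ?case using elim order_trans by blast
    qed
    then show ?thesis by blast
  qed
  then show thesis using that h(1) by blast
qed

lemma specification_AAP_generic_point:
  fixes F :: "nat \<Rightarrow> nat \<Rightarrow> 'a \<Rightarrow> real"
  assumes spec: "has_specification T" and \<mu>: "\<mu> \<in> invariant_measures T" and F: "\<And>i. AAP T (F i)"
  obtains x where "\<And>i. (\<lambda>n. F i n x / real n) \<longlonglongrightarrow> pot_star (F i) \<mu>"
proof -
  have "\<forall>i. \<exists>h. (\<forall>j. continuous_on UNIV (h j)) \<and>
    (\<forall>\<xi>>0. \<exists>j::nat. \<forall>\<^sub>F n in sequentially. \<forall>x. \<bar>F i n x - birk T (h j) n x\<bar> \<le> \<xi> * real n)"
  proof
    fix i
    show "\<exists>h. (\<forall>j. continuous_on UNIV (h j)) \<and>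
      (\<forall>\<xi>>0. \<exists>j::nat. \<forall>\<^sub>F n in sequentially. \<forall>x. \<bar>F i n x - birk T (h j) n x\<bar> \<le> \<xi> * real n)"
      using AAP_countable_approx[OF F[of i]] by blast
  qed
  from choice[OF this] obtain h where h: "\<And>i j. continuous_on UNIV (h i j)"
    "\<And>i \<xi>. \<xi> > 0 \<Longrightarrow> \<exists>j::nat. \<forall>\<^sub>F n in sequentially. \<forall>x. \<bar>F i n x - birk T (h i j) n x\<bar> \<le> \<xi> * real n"
    by blast
  \<comment> \<open>One point must serve all potentials at once, so the double family is enumerated
    as a single sequence.\<close>
  define hh where "hh l = case_prod h (prod_decode l)" for l
  have ch: "continuous_on UNIV (hh l)" for l
    unfolding hh_def using h(1) by (cases "prod_decode l") simp
  obtain x where x: "\<And>l. (\<lambda>n. birk T (hh l) n x / real n) \<longlonglongrightarrow> (\<integral>y. hh l y \<partial>\<mu>)"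
    using specification_generic_point[OF spec \<mu>, of hh] ch by blast
  have lim: "(\<lambda>n. birk T (h i j) n x / real n) \<longlonglongrightarrow> (\<integral>y. h i j y \<partial>\<mu>)" for i j
    using x[of "prod_encode (i, j)"] by (simp add: hh_def)
  have "(\<lambda>n. F i n x / real n) \<longlonglongrightarrow> pot_star (F i) \<mu>" for i
  proof (rule AAP_tendsto_pot_star[OF F \<mu> filterlim_ident])
    fix \<xi> :: real assume "\<xi> > 0"
    then obtain j where "\<forall>\<^sub>F n in sequentially. \<forall>x. \<bar>F i n x - birk T (h i j) n x\<bar> \<le> \<xi> * real n" using h(2) by blast
    then show "\<exists>h. continuous_on UNIV h \<and> (\<forall>\<^sub>F n in sequentially. \<forall>x. \<bar>F i n x - birk T h n x\<bar> \<le> \<xi> * real n) \<and>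
        (\<lambda>n. birk T h n x / real n) \<longlonglongrightarrow> (\<integral>y. h y \<partial>\<mu>)"
      using h(1) lim by blast
  qed
  then show thesis using that by blast
qed

end

theorem theoremE:
  fixes T :: "'a::metric_space \<Rightarrow> 'a"
    and f \<phi> g \<psi> :: "nat \<Rightarrow> 'a \<Rightarrow> real"
    and \<sigma> \<alpha> :: real
  assumes "compact (UNIV :: 'a set)"
    and "continuous_on UNIV T"
    and "has_specification T"
    and "AAP T f" and "AAP T \<phi>" and "AAP T g" and "AAP T \<psi>"
    and "\<sigma> > 0"
    and "\<And>n x. n \<ge> 1 \<Longrightarrow> g n x / real n \<ge> \<sigma>"
    and "\<And>n x. n \<ge> 1 \<Longrightarrow> \<psi> n x / real n \<ge> \<sigma>"
    and "level_set \<phi> \<psi> \<alpha> \<noteq> {}"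
  shows "((SUP x\<in>level_set \<phi> \<psi> \<alpha>. limsup (\<lambda>n. ereal (f n x / g n x)))
           = (SUP \<mu>\<in>{\<mu>\<in>invariant_measures T. pot_star \<phi> \<mu> / pot_star \<psi> \<mu> = \<alpha>}.
                ereal (pot_star f \<mu> / pot_star g \<mu>))
       \<and> (SUP \<mu>\<in>{\<mu>\<in>invariant_measures T. pot_star \<phi> \<mu> / pot_star \<psi> \<mu> = \<alpha>}.
                ereal (pot_star f \<mu> / pot_star g \<mu>))
           = (SUP \<mu>\<in>(\<Union>x\<in>level_set \<phi> \<psi> \<alpha>. empirical_limits T x).
                ereal (pot_star f \<mu> / pot_star g \<mu>)))"
    (is "?S1 = ?S2 \<and> _ = ?S3")
proof -
  interpret compact_dynamics T by unfold_locales (use assms in auto)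
  note f = \<open>AAP T f\<close> and \<phi> = \<open>AAP T \<phi>\<close> and g = \<open>AAP T g\<close> and \<psi> = \<open>AAP T \<psi>\<close>
  have gpos: "pot_star g \<mu> \<noteq> 0" and \<psi>pos: "pot_star \<psi> \<mu> \<noteq> 0" if "\<mu> \<in> invariant_measures T" for \<mu>
    using pot_star_ge[OF g that, of \<sigma>] pot_star_ge[OF \<psi> that, of \<sigma>] assms(8-10) by force+
  have S13: "?S1 \<le> ?S3"
  proof (rule SUP_least)
    fix x assume x: "x \<in> level_set \<phi> \<psi> \<alpha>"
    obtain r where r: "strict_mono r"
      and lim: "((\<lambda>n. ereal (f n x / g n x)) \<circ> r) \<longlonglongrightarrow> limsup (\<lambda>n. ereal (f n x / g n x))"
      using limsup_subseq_lim[of "\<lambda>n. ereal (f n x / g n x)"] by blast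
    obtain s \<mu> where s: "strict_mono s" and \<mu>: "\<mu> \<in> empirical_limits T x"
      and conv: "\<And>h. continuous_on UNIV h \<Longrightarrow> (\<lambda>k. birk T h ((r \<circ> s) k) x / real ((r \<circ> s) k)) \<longlonglongrightarrow> (\<integral>y. h y \<partial>\<mu>)"
      using empirical_limit_subsequence[OF r, where x = x] by blast
    have inv: "\<mu> \<in> invariant_measures T" by (rule empirical_limit_invariant[OF \<mu>])
    have rs: "filterlim (r \<circ> s) at_top sequentially" using r s by (simp add: strict_mono_o filterlim_subseq)
    \<comment> \<open>Along the refined times numerator and denominator, each divided by the time,
      converge separately; the limit of their ratio must be the limsup realised along
      \<open>r\<close>.\<close>
    have "(\<lambda>k. f ((r \<circ> s) k) x / g ((r \<circ> s) k) x) \<longlonglongrightarrow> pot_star f \<mu> / pot_star g \<mu>"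
      using AAP_tendsto_along[OF f inv rs conv] AAP_tendsto_along[OF g inv rs conv] rs gpos[OF inv]
      by (rule ratio_tendsto_along)
    then have "(\<lambda>k. ereal (f ((r \<circ> s) k) x / g ((r \<circ> s) k) x)) \<longlonglongrightarrow> ereal (pot_star f \<mu> / pot_star g \<mu>)" by simp
    moreover have "(\<lambda>k. ereal (f ((r \<circ> s) k) x / g ((r \<circ> s) k) x)) \<longlonglongrightarrow> limsup (\<lambda>n. ereal (f n x / g n x))"
      using LIMSEQ_subseq_LIMSEQ[OF lim s] by (simp add: comp_def)
    ultimately have "limsup (\<lambda>n. ereal (f n x / g n x)) = ereal (pot_star f \<mu> / pot_star g \<mu>)"
      by (rule LIMSEQ_unique[rotated])
    then show "limsup (\<lambda>n. ereal (f n x / g n x)) \<le> ?S3" using x \<mu> by (auto intro!: SUP_upper2)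
  qed
  have S32: "?S3 \<le> ?S2"
  proof (rule SUP_subset_mono)
    show "(\<Union>x\<in>level_set \<phi> \<psi> \<alpha>. empirical_limits T x)
        \<subseteq> {\<mu> \<in> invariant_measures T. pot_star \<phi> \<mu> / pot_star \<psi> \<mu> = \<alpha>}"
    proof
      fix \<mu> assume "\<mu> \<in> (\<Union>x\<in>level_set \<phi> \<psi> \<alpha>. empirical_limits T x)"
      then obtain x where x: "(\<lambda>n. \<phi> n x / \<psi> n x) \<longlonglongrightarrow> \<alpha>" and \<mu>: "\<mu> \<in> empirical_limits T x"
        by (auto simp: level_set_def)
      have inv: "\<mu> \<in> invariant_measures T" by (rule empirical_limit_invariant[OF \<mu>])
      obtain r where r: "strict_mono r"
        and conv: "\<And>h. continuous_on UNIV h \<Longrightarrow> (\<lambda>k. birk T h (r k) x / real (r k)) \<longlonglongrightarrow> (\<integral>y. h y \<partial>\<mu>)"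
        using \<mu> unfolding empirical_limits_def by blast
      have rt: "filterlim r at_top sequentially" using r by (rule filterlim_subseq)
      have "(\<lambda>k. \<phi> (r k) x / \<psi> (r k) x) \<longlonglongrightarrow> pot_star \<phi> \<mu> / pot_star \<psi> \<mu>"
        using AAP_tendsto_along[OF \<phi> inv rt conv] AAP_tendsto_along[OF \<psi> inv rt conv] rt \<psi>pos[OF inv]
        by (rule ratio_tendsto_along)
      moreover have "(\<lambda>k. \<phi> (r k) x / \<psi> (r k) x) \<longlonglongrightarrow> \<alpha>"
        using LIMSEQ_subseq_LIMSEQ[OF x r] by (simp add: comp_def)
      ultimately have "pot_star \<phi> \<mu> / pot_star \<psi> \<mu> = \<alpha>" by (rule LIMSEQ_unique)
      then show "\<mu> \<in> {\<mu> \<in> invariant_measures T. pot_star \<phi> \<mu> / pot_star \<psi> \<mu> = \<alpha>}" using inv by simp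
    qed
  qed simp
  have S21: "?S2 \<le> ?S1"
  proof (rule SUP_least)
    fix \<mu> assume "\<mu> \<in> {\<mu> \<in> invariant_measures T. pot_star \<phi> \<mu> / pot_star \<psi> \<mu> = \<alpha>}"
    then have inv: "\<mu> \<in> invariant_measures T" and \<alpha>: "pot_star \<phi> \<mu> / pot_star \<psi> \<mu> = \<alpha>" by auto
    \<comment> \<open>The four potentials are repeated periodically to form a sequence indexed by
      all naturals.\<close>
    define F where "F i = [f, g, \<phi>, \<psi>] ! (i mod 4)" for i :: nat
    have "F i \<in> {f, g, \<phi>, \<psi>}" for i
      using nth_mem[of "i mod 4" "[f, g, \<phi>, \<psi>]"] by (simp add: F_def)
    then have "AAP T (F i)" for i using f g \<phi> \<psi> by (metis empty_iff insert_iff)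
    then obtain x where "\<And>i. (\<lambda>n. F i n x / real n) \<longlonglongrightarrow> pot_star (F i) \<mu>"
      using specification_AAP_generic_point[OF assms(3) inv] by blast
    from this[of 0] this[of 1] this[of 2] this[of 3]
    have x: "(\<lambda>n. f n x / real n) \<longlonglongrightarrow> pot_star f \<mu>" "(\<lambda>n. g n x / real n) \<longlonglongrightarrow> pot_star g \<mu>"
      "(\<lambda>n. \<phi> n x / real n) \<longlonglongrightarrow> pot_star \<phi> \<mu>" "(\<lambda>n. \<psi> n x / real n) \<longlonglongrightarrow> pot_star \<psi> \<mu>"
      by (simp_all add: F_def)
    \<comment> \<open>Along this orbit the averages converge for the full sequence of times: the
      constraint on \<mu> puts \<open>x\<close> in the level set, and the limsup is a limit.\<close>
    have "x \<in> level_set \<phi> \<psi> \<alpha>"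
      using ratio_tendsto_along[OF x(3,4) filterlim_ident \<psi>pos[OF inv]] \<alpha> by (simp add: level_set_def)
    moreover have "(\<lambda>n. ereal (f n x / g n x)) \<longlonglongrightarrow> ereal (pot_star f \<mu> / pot_star g \<mu>)"
      using ratio_tendsto_along[OF x(1,2) filterlim_ident gpos[OF inv]] by simp
    then have "limsup (\<lambda>n. ereal (f n x / g n x)) = ereal (pot_star f \<mu> / pot_star g \<mu>)"
      by (rule lim_imp_Limsup[OF trivial_limit_sequentially])
    ultimately show "ereal (pot_star f \<mu> / pot_star g \<mu>) \<le> ?S1" by (metis (no_types, lifting) SUP_upper)
  qed
  show ?thesis
    using antisym[OF order.trans[OF S13 S32] S21] antisym[OF order.trans[OF S21 S13] S32] by (rule conjI)
qed

end
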